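(* Let $M$ be an $n$-dimensional minimal hypersurface in the unit sphere $\mathbb{S}^{n+1}$. If $n\geq 6$, $\eta>0$, and $n\leq S\leq(1+\eta^{-1})n$ on $M$, then at every point of $M$ \[ 3(A-2B)\leq\left(S+4+\sqrt[3]{cF}\right)|\nabla h|^2, \] where $c=\frac{24}{5}-\frac{16}{(1+\eta^{-1})n}$.
   Context: $\mathbb{S}^{n+1}$ is the unit sphere with its standard round metric. Let $\nu$ be a local unit normal field of $M$ and $\{e_i\}_{1\le i\le n}$ a local orthonormal tangent frame; write the second fundamental form as $h(e_i,e_j)=h_{ij}\nu$. Minimal means $\sum_i h_{ii}=0$. Put $S=\sum_{i,j}h_{ij}^2$. Let $h_{ijk}$ be the components of the covariant derivative of $h_{ij}$ (symmetric in $i,j,k$ by the Codazzi equation), and $|\nabla h|^2=\sum_{i,j,k}h_{ijk}^2$. Define \[ A=\sum_{i,j,k,l,m}h_{ijk}h_{ijl}h_{km}h_{ml},\qquad B=\sum_{i,j,k,l,m}h_{ijk}h_{klm}h_{im}h_{jl}. \] Let $\lambda_1,\dots,\lambda_n$ be the principal curvatures (eigenvalues of $(h_{ij})$) at a point, and define \[ F=\sum_{i,j}(\lambda_i-\lambda_j)^2(1+\lambda_i\lambda_j)^2 . \] All indices range from $1$ to $n$. *)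

theory Defs
  imports "HOL-Analysis.Analysis"
begin

section \<open>Smooth maps on open sets\<close>

primrec Ck_on :: "nat \<Rightarrow> ('a::euclidean_space \<Rightarrow> 'b::real_normed_vector) \<Rightarrow> 'a set \<Rightarrow> bool" where
  "Ck_on 0 f U \<longleftrightarrow> continuous_on U f"
| "Ck_on (Suc k) f U \<longleftrightarrow> (\<forall>u\<in>U. f differentiable (at u)) \<and>
     (\<forall>v. Ck_on k (\<lambda>u. frechet_derivative f (at u) v) U)"

definition smooth_on :: "('a::euclidean_space \<Rightarrow> 'b::real_normed_vector) \<Rightarrow> 'a set \<Rightarrow> bool" where
  "smooth_on f U \<longleftrightarrow> (\<forall>k. Ck_on k f U)"


section \<open>Immersed hypersurfaces of the unit sphere\<close>

text \<open>A chart is given by its inverse, a local parametrization: the pair \<open>(U, \<phi>)\<close> stands for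
  \<open>\<phi> : U \<rightarrow> M\<close> with \<open>U\<close> open in \<open>n\<close>-dimensional Euclidean space, where \<open>n = CARD('n)\<close>.\<close>

type_synonym ('n, 'm) atlas = "((real ^ 'n) set \<times> (real ^ 'n \<Rightarrow> 'm)) set"

definition smooth_manifold :: "'m topology \<Rightarrow> ('n::finite, 'm) atlas \<Rightarrow> bool" where
  "smooth_manifold M \<A> \<longleftrightarrow>
     Hausdorff_space M \<and> second_countable M \<and>
     topspace M = (\<Union>(U, \<phi>)\<in>\<A>. \<phi> ` U) \<and>
     (\<forall>(U, \<phi>)\<in>\<A>. open U \<and> openin M (\<phi> ` U) \<and>
        homeomorphic_map (top_of_set U) (subtopology M (\<phi> ` U)) \<phi>) \<and>
     (\<forall>(U, \<phi>)\<in>\<A>. \<forall>(V, \<psi>)\<in>\<A>. smooth_on (inv_into V \<psi> \<circ> \<phi>) (U \<inter> \<phi> -` (\<psi> ` V)))"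

text \<open>The sphere of dimension \<open>n + 1\<close> is the unit sphere of an \<open>(n + 2)\<close>-dimensional Euclidean
  space \<open>'v\<close>, and \<open>M\<close> carries the metric induced by the immersion \<open>x\<close>. Embedded hypersurfaces are
  the case where \<open>x\<close> is a topological embedding.\<close>

definition sphere_hypersurface ::
  "'m topology \<Rightarrow> ('n::finite, 'm) atlas \<Rightarrow> ('m \<Rightarrow> 'v::euclidean_space) \<Rightarrow> bool" where
  "sphere_hypersurface M \<A> x \<longleftrightarrow>
     smooth_manifold M \<A> \<and> DIM('v) = CARD('n) + 2 \<and> x ` topspace M \<subseteq> sphere 0 1 \<and>
     (\<forall>(U, \<phi>)\<in>\<A>. smooth_on (x \<circ> \<phi>) U \<and>
        (\<forall>u\<in>U. inj (frechet_derivative (x \<circ> \<phi>) (at u))))"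


section \<open>Local frames\<close>

text \<open>In what follows \<open>X = x \<circ> \<phi>\<close> is the immersion in a parametrization, and a tangent vector field
  of \<open>M\<close> is given by its coefficient function \<open>a\<close> with values in \<open>real ^ 'n\<close>; as a field of vectors
  of the ambient Euclidean space it is \<open>push X a\<close>. The derivative of a function \<open>f\<close> along it is
  \<open>along a f\<close>.\<close>

definition along :: "(real ^ 'n::finite \<Rightarrow> real ^ 'n) \<Rightarrow> (real ^ 'n \<Rightarrow> 'b::real_normed_vector) \<Rightarrow>
    real ^ 'n \<Rightarrow> 'b" where
  "along a f u = frechet_derivative f (at u) (a u)"

abbreviation push :: "(real ^ 'n::finite \<Rightarrow> 'v::euclidean_space) \<Rightarrow> (real ^ 'n \<Rightarrow> real ^ 'n) \<Rightarrow>
    real ^ 'n \<Rightarrow> 'v" where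
  "push X a \<equiv> along a X"

text \<open>\<open>e\<close> is a smooth orthonormal tangent frame on \<open>W\<close>, and \<open>\<nu>\<close> a smooth unit normal field of the
  hypersurface, tangent to the sphere.\<close>

definition orthonormal_frame_on ::
  "(real ^ 'n::finite) set \<Rightarrow> (real ^ 'n \<Rightarrow> 'v::euclidean_space) \<Rightarrow>
   ('n \<Rightarrow> real ^ 'n \<Rightarrow> real ^ 'n) \<Rightarrow> (real ^ 'n \<Rightarrow> 'v) \<Rightarrow> bool" where
  "orthonormal_frame_on W X e \<nu> \<longleftrightarrow>
     open W \<and> (\<forall>i. smooth_on (e i) W) \<and> smooth_on \<nu> W \<and>
     (\<forall>u\<in>W. (\<forall>i j. push X (e i) u \<bullet> push X (e j) u = (if i = j then 1 else 0)) \<and>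
        norm (\<nu> u) = 1 \<and> \<nu> u \<bullet> X u = 0 \<and> (\<forall>i. \<nu> u \<bullet> push X (e i) u = 0))"

text \<open>\<open>(X, e, \<nu>)\<close> is such a frame in a parametrization near the point \<open>p\<close>, which has parameter \<open>u\<close>.\<close>

definition frame_at ::
  "('n::finite, 'm) atlas \<Rightarrow> ('m \<Rightarrow> 'v::euclidean_space) \<Rightarrow> 'm \<Rightarrow> (real ^ 'n \<Rightarrow> 'v) \<Rightarrow>
   ('n \<Rightarrow> real ^ 'n \<Rightarrow> real ^ 'n) \<Rightarrow> (real ^ 'n \<Rightarrow> 'v) \<Rightarrow> real ^ 'n \<Rightarrow> bool" where
  "frame_at \<A> x p X e \<nu> u \<longleftrightarrow>
     (\<exists>U \<phi> W. (U, \<phi>) \<in> \<A> \<and> W \<subseteq> U \<and> u \<in> W \<and> \<phi> u = p \<and> X = x \<circ> \<phi> \<and>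
        orthonormal_frame_on W X e \<nu>)"


section \<open>The second fundamental form and its covariant derivative\<close>

text \<open>Since \<open>\<nu>\<close> is orthogonal to the position vector, the \<open>\<nu>\<close>-component of the Euclidean derivative
  is that of the Levi-Civita connection of the sphere.\<close>

definition sff ::
  "(real ^ 'n::finite \<Rightarrow> 'v::euclidean_space) \<Rightarrow> ('n \<Rightarrow> real ^ 'n \<Rightarrow> real ^ 'n) \<Rightarrow>
   (real ^ 'n \<Rightarrow> 'v) \<Rightarrow> 'n \<Rightarrow> 'n \<Rightarrow> real ^ 'n \<Rightarrow> real" where
  "sff X e \<nu> i j u = along (e i) (push X (e j)) u \<bullet> \<nu> u"

text \<open>\<open>conn X e k i l\<close> is the component along \<open>e l\<close> of the Levi-Civita derivative of \<open>e i\<close> in the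
  direction \<open>e k\<close>; the Levi-Civita connection of \<open>M\<close> is the tangential part of the Euclidean
  derivative.\<close>

definition conn ::
  "(real ^ 'n::finite \<Rightarrow> 'v::euclidean_space) \<Rightarrow> ('n \<Rightarrow> real ^ 'n \<Rightarrow> real ^ 'n) \<Rightarrow>
   'n \<Rightarrow> 'n \<Rightarrow> 'n \<Rightarrow> real ^ 'n \<Rightarrow> real" where
  "conn X e k i l u = along (e k) (push X (e i)) u \<bullet> push X (e l) u"

text \<open>\<open>h\<^sub>i\<^sub>j\<^sub>k\<close> is the covariant derivative of \<open>h\<close> in the direction \<open>e k\<close>, evaluated on \<open>e i\<close>, \<open>e j\<close>.\<close>

definition dsff ::
  "(real ^ 'n::finite \<Rightarrow> 'v::euclidean_space) \<Rightarrow> ('n \<Rightarrow> real ^ 'n \<Rightarrow> real ^ 'n) \<Rightarrow>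
   (real ^ 'n \<Rightarrow> 'v) \<Rightarrow> 'n \<Rightarrow> 'n \<Rightarrow> 'n \<Rightarrow> real ^ 'n \<Rightarrow> real" where
  "dsff X e \<nu> i j k u = along (e k) (sff X e \<nu> i j) u
     - (\<Sum>l\<in>UNIV. conn X e k i l u * sff X e \<nu> l j u)
     - (\<Sum>l\<in>UNIV. conn X e k j l u * sff X e \<nu> i l u)"

definition minimal_sphere_hypersurface ::
  "'m topology \<Rightarrow> ('n::finite, 'm) atlas \<Rightarrow> ('m \<Rightarrow> 'v::euclidean_space) \<Rightarrow> bool" where
  "minimal_sphere_hypersurface M \<A> x \<longleftrightarrow>
     sphere_hypersurface M \<A> x \<and>
     (\<forall>p\<in>topspace M. \<forall>X e \<nu> u. frame_at \<A> x p X e \<nu> u \<longrightarrow> (\<Sum>i\<in>UNIV. sff X e \<nu> i i u) = 0)"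


section \<open>Scalar invariants\<close>

text \<open>The arguments \<open>h\<close> and \<open>dh\<close> are the components \<open>h\<^sub>i\<^sub>j\<close> and \<open>h\<^sub>i\<^sub>j\<^sub>k\<close> at a point.\<close>

definition S_of :: "('n::finite \<Rightarrow> 'n \<Rightarrow> real) \<Rightarrow> real" where
  "S_of h = (\<Sum>i\<in>UNIV. \<Sum>j\<in>UNIV. (h i j)\<^sup>2)"

definition grad_norm2 :: "('n::finite \<Rightarrow> 'n \<Rightarrow> 'n \<Rightarrow> real) \<Rightarrow> real" where
  "grad_norm2 dh = (\<Sum>i\<in>UNIV. \<Sum>j\<in>UNIV. \<Sum>k\<in>UNIV. (dh i j k)\<^sup>2)"

definition A_of :: "('n::finite \<Rightarrow> 'n \<Rightarrow> real) \<Rightarrow> ('n \<Rightarrow> 'n \<Rightarrow> 'n \<Rightarrow> real) \<Rightarrow> real" where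
  "A_of h dh = (\<Sum>i\<in>UNIV. \<Sum>j\<in>UNIV. \<Sum>k\<in>UNIV. \<Sum>l\<in>UNIV. \<Sum>m\<in>UNIV.
     dh i j k * dh i j l * h k m * h m l)"

definition B_of :: "('n::finite \<Rightarrow> 'n \<Rightarrow> real) \<Rightarrow> ('n \<Rightarrow> 'n \<Rightarrow> 'n \<Rightarrow> real) \<Rightarrow> real" where
  "B_of h dh = (\<Sum>i\<in>UNIV. \<Sum>j\<in>UNIV. \<Sum>k\<in>UNIV. \<Sum>l\<in>UNIV. \<Sum>m\<in>UNIV.
     dh i j k * dh k l m * h i m * h j l)"

text \<open>The family \<open>\<kappa>\<close> lists the eigenvalues of \<open>(h\<^sub>i\<^sub>j)\<close> with multiplicity, i.e. the roots of the
  characteristic polynomial.\<close>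

definition principal_curvatures :: "('n::finite \<Rightarrow> 'n \<Rightarrow> real) \<Rightarrow> ('n \<Rightarrow> real) \<Rightarrow> bool" where
  "principal_curvatures h \<kappa> \<longleftrightarrow>
     (\<forall>t. det (mat t - (\<chi> i j. h i j)) = (\<Prod>i\<in>UNIV. t - \<kappa> i))"

definition F_of :: "('n::finite \<Rightarrow> real) \<Rightarrow> real" where
  "F_of \<kappa> = (\<Sum>i\<in>UNIV. \<Sum>j\<in>UNIV. (\<kappa> i - \<kappa> j)\<^sup>2 * (1 + \<kappa> i * \<kappa> j)\<^sup>2)"

end

theory Submission
  imports Defs "HOL-Computational_Algebra.Polynomial"
begin

text \<open>By the Codazzi equation \<open>h\<^sub>i\<^sub>j\<^sub>k\<close> is totally symmetric, so in a frame of eigenvectors of \<open>h\<close>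
  \<open>3(A - 2B)\<close> is the sum of \<open>h\<^sub>i\<^sub>j\<^sub>k\<^sup>2 \<Phi>(\<lambda>\<^sub>i, \<lambda>\<^sub>j, \<lambda>\<^sub>k)\<close>, where
  \<open>\<Phi>(x, y, z) = x\<^sup>2 + y\<^sup>2 + z\<^sup>2 - 2(xy + yz + zx)\<close>. It therefore suffices to bound \<open>\<Phi>\<close> at each
  triple of principal curvatures. If the excess \<open>w = \<Phi> - S - 4\<close> is positive, some of the curvatures
  have opposite signs and products below \<open>-1\<close>, which makes the corresponding summands of \<open>F\<close> large
  enough for \<open>w\<^sup>3 \<le> cF\<close>. The critical case is that of two equal indices,
  \<open>w \<le> 4(az - 1) - a\<^sup>2\<close> for curvatures \<open>a\<close> and \<open>-z\<close>: its leading part yields the constant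
  \<open>24/5\<close>, and the lower-order terms leave room for \<open>16/S\<close> because \<open>a\<^sup>2 + z\<^sup>2 \<le> S\<close>.\<close>

section \<open>The critical pair inequality\<close>

text \<open>The coefficients below arise in \<open>pair_core\<close> from expanding a polynomial around \<open>P = 13/10\<close>; on
  each of the two intervals the Bernstein coefficients are nonnegative.\<close>

lemma shifted_coeff0:
  fixes b :: real
  assumes "0 \<le> b" "b \<le> 3 / 2"
  shows "0 \<le> 13432368 + (- 24427104) * b + 17600336 * b^2 + (- 13167804) * b^3 + 8672573 * b^4
      + (- 1713660) * b^5 + 142805 * b^6" (is "0 \<le> ?p")
proof (cases "b \<le> 23/20")
  case True
  \<comment> \<open>Homogenization of degree 6 in \<open>b\<close> and \<open>23/20 - b\<close>,
    whose sum is the interval length. The factor \<open>148035889 = 23^6\<close> is the sixth power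
    of that length up to denominators.\<close>
  have "148035889/5 * ?p = 171934310400000 * (23/20 - b)^6 + 672038891520000 * b * (23/20 - b)^5
      + 1079118289408000 * b^2 * (23/20 - b)^4 + 778430176403200 * b^3 * (23/20 - b)^3
      + 196110372033040 * b^4 * (23/20 - b)^2 + 695963106960 * b^5 * (23/20 - b) + 8230112214849 * b^6"
    by algebra
  moreover have "0 \<le> \<dots>"
    using assms True by (intro add_nonneg_nonneg mult_nonneg_nonneg zero_le_power) auto
  ultimately show ?thesis
    by (simp add: zero_le_mult_iff)
next
  case False
  have "117649/5 * ?p = 8230112214849 * (3/2 - b)^6 + 64197758996700 * (b - 23/20) * (3/2 - b)^5
      + 226815050789740 * (b - 23/20)^2 * (3/2 - b)^4 + 434498426672800 * (b - 23/20)^3 * (3/2 - b)^3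
      + 461448183238000 * (b - 23/20)^4 * (3/2 - b)^2 + 255004205400000 * (b - 23/20)^5 * (3/2 - b)
      + 57210405000000 * (b - 23/20)^6"
    by algebra
  moreover have "0 \<le> \<dots>"
    using assms False by (intro add_nonneg_nonneg mult_nonneg_nonneg zero_le_power) auto
  ultimately show ?thesis
    by (simp add: zero_le_mult_iff)
qed

lemma shifted_coeff1:
  fixes b :: real
  assumes "0 \<le> b" "b \<le> 3 / 2"
  shows "0 \<le> 584016 + (- 1385888) * b + 1194752 * b^2 + (- 896168) * b^3 + 659646 * b^4
      + (- 131820) * b^5 + 10985 * b^6" (is "0 \<le> ?p")
proof (cases "b \<le> 7/8")
  case True
  have "117649 * ?p = 153096290304 * (7/8 - b)^6 + 600688295936 * b * (7/8 - b)^5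
      + 946788630528 * b^2 * (7/8 - b)^4 + 684815929344 * b^3 * (7/8 - b)^3
      + 185518452608 * b^4 * (7/8 - b)^2 + 1155911520 * b^5 * (7/8 - b) + 2549137625 * b^6"
    by algebra
  moreover have "0 \<le> \<dots>"
    using assms True by (intro add_nonneg_nonneg mult_nonneg_nonneg zero_le_power) auto
  ultimately show ?thesis
    by (simp add: zero_le_mult_iff)
next
  case False
  have "15625 * ?p = 2549137625 * (3/2 - b)^6 + 25394050200 * (b - 7/8) * (3/2 - b)^5
      + 199945410800 * (b - 7/8)^2 * (3/2 - b)^4 + 632057683200 * (b - 7/8)^3 * (3/2 - b)^3
      + 920567596800 * (b - 7/8)^4 * (3/2 - b)^2 + 631214643200 * (b - 7/8)^5 * (3/2 - b)
      + 165775872000 * (b - 7/8)^6"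
    by algebra
  moreover have "0 \<le> \<dots>"
    using assms False by (intro add_nonneg_nonneg mult_nonneg_nonneg zero_le_power) auto
  ultimately show ?thesis
    by (simp add: zero_le_mult_iff)
qed

lemma shifted_coeff2:
  fixes b :: real
  assumes "0 \<le> b" "b \<le> 3 / 2"
  shows "0 \<le> 76176 + (- 231008) * b + 239792 * b^2 + (- 182868) * b^3 + 150751 * b^4
      + (- 30420) * b^5 + 2535 * b^6" (is "0 \<le> ?p")
proof (cases "b \<le> 27/40")
  case True
  have "387420489/5 * ?p = 62403379200000 * (27/40 - b)^6 + 246682091520000 * b * (27/40 - b)^5
      + 386861654016000 * b^2 * (27/40 - b)^4 + 282621082060800 * b^3 * (27/40 - b)^3
      + 83100433187520 * b^4 * (27/40 - b)^2 + 3302103849120 * b^5 * (27/40 - b) + 436233214323 * b^6"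
    by algebra
  moreover have "0 \<le> \<dots>"
    using assms True by (intro add_nonneg_nonneg mult_nonneg_nonneg zero_le_power) auto
  ultimately show ?thesis
    by (simp add: zero_le_mult_iff)
next
  case False
  have "1291467969/5 * ?p = 436233214323 * (3/2 - b)^6 + 1780538153160 * (b - 27/40) * (3/2 - b)^5
      + 111607869970320 * (b - 27/40)^2 * (3/2 - b)^4 + 483879667987200 * (b - 27/40)^3 * (3/2 - b)^3
      + 818075901216000 * (b - 27/40)^4 * (3/2 - b)^2 + 618349344000000 * (b - 27/40)^5 * (3/2 - b)
      + 174544320000000 * (b - 27/40)^6"
    by algebra
  moreover have "0 \<le> \<dots>"
    using assms False by (intro add_nonneg_nonneg mult_nonneg_nonneg zero_le_power) auto
  ultimately show ?thesis
    by (simp add: zero_le_mult_iff)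
qed

lemma shifted_coeff3:
  fixes b :: real
  assumes "0 \<le> b" "b \<le> 3 / 2"
  shows "0 \<le> 2208 + (- 8384) * b + 10496 * b^2 + (- 8304) * b^3 + 7668 * b^4 + (- 1560) * b^5
      + 130 * b^6" (is "0 \<le> ?p")
proof (cases "b \<le> 11/20")
  case True
  have "1771561/10 * ?p = 14131200000 * (11/20 - b)^6 + 55275520000 * b * (11/20 - b)^5
      + 84729856000 * b^2 * (11/20 - b)^4 + 59946124800 * b^3 * (11/20 - b)^3
      + 16737125920 * b^4 * (11/20 - b)^2 + 462422320 * b^5 * (11/20 - b) + 108915493 * b^6"
    by algebra
  moreover have "0 \<le> \<dots>"
    using assms True by (intro add_nonneg_nonneg mult_nonneg_nonneg zero_le_power) auto
  ultimately show ?thesis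
    by (simp add: zero_le_mult_iff)
next
  case False
  have "47045881/10 * ?p = 108915493 * (3/2 - b)^6 + 983524060 * (b - 11/20) * (3/2 - b)^5
      + 51194694220 * (b - 11/20)^2 * (3/2 - b)^4 + 220602535200 * (b - 11/20)^3 * (3/2 - b)^3
      + 383524846000 * (b - 11/20)^4 * (3/2 - b)^2 + 300155800000 * (b - 11/20)^5 * (3/2 - b)
      + 87525000000 * (b - 11/20)^6"
    by algebra
  moreover have "0 \<le> \<dots>"
    using assms False by (intro add_nonneg_nonneg mult_nonneg_nonneg zero_le_power) auto
  ultimately show ?thesis
    by (simp add: zero_le_mult_iff)
qed

text \<open>Gives the sign of the leading coefficient in \<open>pair_core\<close>, and so accounts
  for the constant \<open>24/5\<close> (here doubled). The square of
  \<open>b^2 - 6 * b + 5/2\<close> absorbs the quartic and cubic terms; the quotient of the two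
  sides is nearly 1 around \<open>b = 1/2\<close>, so there is little room for a smaller
  constant.\<close>

lemma quartic_certificate:
  fixes b :: real
  shows "b * (4 - b)^3 \<le> 48 / 5 * (1 + b)^2"
proof -
  have "48 / 5 * (1 + b)^2 - b * (4 - b)^3
      = (b^2 - 6 * b + 5 / 2)^2 + 83 / 5 * (b - 37 / 83)^2 + 17 / 332"
    by (simp add: field_simps power2_eq_square power3_eq_cube)
  moreover have "\<dots> \<ge> 0"
    by (intro add_nonneg_nonneg mult_nonneg_nonneg) auto
  ultimately show ?thesis
    by linarith
qed

text \<open>The same device for small \<open>P\<close>: \<open>64/15\<close> is
  \<open>48/5 - 32/S\<close> at \<open>S = 6\<close>, and \<open>10/13\<close> is \<open>1/P\<close>
  at \<open>P = 13/10\<close>, a lower bound for \<open>1/P\<close> when \<open>P\<close> is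
  smaller.\<close>

lemma quartic_certificate_small:
  fixes b :: real
  shows "b * (4 - b)^3 \<le> 64 / 15 * (1 + b + 10 / 13)^2"
proof -
  have "64 / 15 * (1 + b + 10 / 13)^2 - b * (4 - b)^3
      = (b^2 - 6 * b + 31 / 10)^2 + 151 / 15 * (b - 1141 / 1963)^2
        + (189893 / 50700 - 151 / 15 * (1141 / 1963)^2)"
    by (simp add: field_simps power2_eq_square power3_eq_cube)
  moreover have "\<dots> \<ge> 0"
    by (intro add_nonneg_nonneg mult_nonneg_nonneg) (auto simp: power2_eq_square)
  ultimately show ?thesis
    by linarith
qed

text \<open>For curvatures \<open>a\<close> and \<open>-z\<close> with \<open>P = az - 1\<close> and \<open>a\<^sup>2 = bP\<close>, the last hypothesis is
  \<open>a\<^sup>2 + z\<^sup>2 \<le> S\<close> multiplied by \<open>a\<^sup>2\<close>. For small \<open>P\<close> or large \<open>b\<close> the hypothesis \<open>6 \<le> S\<close>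
  suffices.\<close>

lemma pair_core:
  fixes b P S :: real
  assumes b: "0 < b" "b < 4" and P: "0 < P" and S: "6 \<le> S" "b^2 * P^2 + (P + 1)^2 \<le> S * (b * P)"
  shows "b * (4 - b)^3 * P^2 \<le> (48 / 5 - 32 / S) * ((1 + b) * P + 1)^2"
proof -
  define g where "g = b * (4 - b)^3"
  consider (large_b) "3 / 2 \<le> b" | (small_P) "P \<le> 13 / 10" | (main) "b \<le> 3 / 2" "13 / 10 \<le> P"
    by linarith
  then show ?thesis
  proof cases
    case main
    \<comment> \<open>The right-hand side grows with \<open>S\<close>, so \<open>S\<close> may be
      replaced by its lower bound \<open>N / (b * P)\<close>. Multiplied by \<open>N\<close>, the
      claim is polynomial; expanded in \<open>p = P - 13/10\<close>, which is nonnegative here, it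
      needs only nonnegative coefficients.\<close>
    define N where "N = b^2 * P^2 + (P + 1)^2"
    have N: "0 < N"
      using P by (auto simp: N_def intro!: add_nonneg_pos)
    define p where "p = P - 13 / 10"
    define d0 where "d0 = 13432368 + (- 24427104) * b + 17600336 * b^2 + (- 13167804) * b^3
        + 8672573 * b^4 + (- 1713660) * b^5 + 142805 * b^6"
    define d1 where "d1 = 584016 + (- 1385888) * b + 1194752 * b^2 + (- 896168) * b^3 + 659646 * b^4
        + (- 131820) * b^5 + 10985 * b^6"
    define d2 where "d2 = 76176 + (- 231008) * b + 239792 * b^2 + (- 182868) * b^3 + 150751 * b^4
        + (- 30420) * b^5 + 2535 * b^6"
    define d3 where "d3 = 2208 + (- 8384) * b + 10496 * b^2 + (- 8304) * b^3 + 7668 * b^4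
        + (- 1560) * b^5 + 130 * b^6"
    have d: "0 \<le> d0" "0 \<le> d1" "0 \<le> d2" "0 \<le> d3"
      using main b unfolding d0_def d1_def d2_def d3_def
      by (intro shifted_coeff0 shifted_coeff1 shifted_coeff2 shifted_coeff3; simp)+
    have "(48 / 5 * N - 32 * (b * P)) * ((1 + b) * P + 1)^2 - g * P^2 * N
      = d0 / 50000 + d1 / 1250 * p + d2 / 250 * p^2 + d3 / 25 * p^3 + (1 + b^2) * (48 / 5 * (1 + b)^2 - g) * p^4"
      unfolding N_def p_def g_def d0_def d1_def d2_def d3_def by algebra
    also have "\<dots> \<ge> 0"
      using main d quartic_certificate[of b]
      by (intro add_nonneg_nonneg mult_nonneg_nonneg divide_nonneg_nonneg zero_le_power)
         (auto simp: p_def g_def b(1) less_imp_le)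
    finally have "g * P^2 * N \<le> (48 / 5 * N - 32 * (b * P)) * ((1 + b) * P + 1)^2"
      by simp
    then have "g * P^2 \<le> (48 / 5 - 32 * (b * P / N)) * ((1 + b) * P + 1)^2"
      using N by (simp add: field_simps)
    also have "\<dots> \<le> (48 / 5 - 32 / S) * ((1 + b) * P + 1)^2"
    proof (intro mult_right_mono)
      have "1 / S \<le> b * P / N"
        using S N by (simp add: N_def field_simps)
      then show "48 / 5 - 32 * (b * P / N) \<le> 48 / 5 - 32 / S"
        by simp
    qed auto
    finally show ?thesis
      by (simp add: g_def)
  next
    case large_b
    \<comment> \<open>The quartic is at most 25 here, while \<open>64/15 * (5/2)^2\<close> exceeds
      26; the summand 1 on the right can be given away.\<close>
    have "b * (4 - b) \<le> 4"
      using zero_le_power2[of "b - 2"] by (simp add: power2_eq_square algebra_simps)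
    moreover have "(4 - b)^2 \<le> (5 / 2)^2"
      using large_b b by (intro power_mono) auto
    ultimately have "(b * (4 - b)) * (4 - b)^2 \<le> 4 * (5 / 2)^2"
      by (intro mult_mono) (use b in auto)
    also have "\<dots> \<le> 64 / 15 * (5 / 2)^2"
      by (simp add: power2_eq_square)
    also have "\<dots> \<le> 64 / 15 * (1 + b)^2"
      using large_b by (intro mult_left_mono power_mono) auto
    finally have "g \<le> 64 / 15 * (1 + b)^2"
      by (simp add: g_def power2_eq_square power3_eq_cube algebra_simps)
    then have "g * P^2 \<le> 64 / 15 * (1 + b)^2 * P^2"
      by (intro mult_right_mono) auto
    also have "\<dots> = 64 / 15 * ((1 + b) * P)^2"
      by (simp add: power_mult_distrib)
    also have "\<dots> \<le> 64 / 15 * ((1 + b) * P + 1)^2"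
      using b P by (intro mult_left_mono power_mono) auto
    also have "\<dots> \<le> (48 / 5 - 32 / S) * ((1 + b) * P + 1)^2"
      using S by (intro mult_right_mono) (auto simp: field_simps)
    finally show ?thesis
      by (simp add: g_def)
  next
    case small_P
    have "g * P^2 \<le> 64 / 15 * (1 + b + 10 / 13)^2 * P^2"
      using quartic_certificate_small[of b] by (intro mult_right_mono) (auto simp: g_def)
    also have "\<dots> = 64 / 15 * ((1 + b + 10 / 13) * P)^2"
      by (simp add: power_mult_distrib)
    also have "\<dots> \<le> 64 / 15 * ((1 + b) * P + 1)^2"
      using b P small_P by (intro mult_left_mono power_mono) (auto simp: algebra_simps)
    also have "\<dots> \<le> (48 / 5 - 32 / S) * ((1 + b) * P + 1)^2"
      using S by (intro mult_right_mono) (auto simp: field_simps)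
    finally show ?thesis
      by (simp add: g_def)
  qed
qed

text \<open>With \<open>P = a * z - 1\<close> and \<open>a^2 = b * P\<close> one has
  \<open>4 * P - a^2 = (4 - b) * P\<close> and \<open>a * (a + z) = (1 + b) * P + 1\<close>, so
  \<open>a^2\<close> times the claim is \<open>P^2\<close> times \<open>pair_core\<close>. The
  factor 2 reflects that \<open>F\<close> counts each unordered pair twice.\<close>

lemma pair_estimate:
  fixes a z S c :: real
  assumes a: "0 < a" and z: "0 < z" and S: "6 \<le> S" "a^2 + z^2 \<le> S"
    and c: "24 / 5 - 16 / S \<le> c" and w: "0 < 4 * (a * z - 1) - a^2"
  shows "(4 * (a * z - 1) - a^2)^3 \<le> 2 * c * ((a + z)^2 * (a * z - 1)^2)"
proof -
  define P where "P = a * z - 1"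
  define b where "b = a^2 / P"
  have "0 < 4 * P - a^2"
    using w by (simp add: P_def)
  with zero_le_power2[of a] have P: "0 < P"
    by linarith
  have a2: "a^2 = b * P"
    using P by (simp add: b_def)
  have z': "z = (P + 1) / a"
    using a by (simp add: P_def)
  have b: "0 < b" "b < 4"
    using a P w by (simp_all add: b_def P_def[symmetric] field_simps)
  have "(a^2 + z^2) * a^2 \<le> S * a^2"
    using S by (intro mult_right_mono) auto
  moreover have "(a^2 + z^2) * a^2 = b^2 * P^2 + (P + 1)^2"
    using a by (simp add: z' power_divide add_divide_distrib distrib_right a2[symmetric] power_mult_distrib[symmetric])
       (simp add: power2_eq_square power4_eq_xxxx)
  ultimately have "b^2 * P^2 + (P + 1)^2 \<le> S * (b * P)"
    by (simp add: a2)
  from pair_core[OF b P S(1) this]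
  have "b * (4 - b)^3 * P^2 * P^2 \<le> (48 / 5 - 32 / S) * ((1 + b) * P + 1)^2 * P^2"
    by (intro mult_right_mono) auto
  also have "\<dots> \<le> (2 * c) * ((1 + b) * P + 1)^2 * P^2"
    using c by (intro mult_right_mono) auto
  also have "(1 + b) * P + 1 = a * (a + z)"
    using a2 by (simp add: P_def algebra_simps power2_eq_square)
  also have "b * (4 - b)^3 * P^2 * P^2 = a^2 * (4 * P - a^2)^3"
    unfolding a2 by algebra
  finally have "a^2 * (4 * P - a^2)^3 \<le> a^2 * (2 * c * ((a + z)^2 * P^2))"
    by (simp add: power_mult_distrib mult_ac)
  then show ?thesis
    using a by (simp add: P_def)
qed

section \<open>Bounds for triples of principal curvatures\<close>

text \<open>The difference of the two sides is a quadratic polynomial in \<open>r - E\<close>: either its discriminant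
  is nonpositive or all its coefficients are nonnegative.\<close>

lemma triple_core:
  fixes r E P :: real
  assumes E: "0 \<le> E" "E \<le> r" and P: "0 < P" and w: "0 \<le> 2 * P - E"
  shows "r * (2 * P - E)^3 \<le> P^2 * (2 * r + P - E)^2"
proof -
  define D where "D = r - E"
  define g where "g = (2 * P - E)^3"
  define B where "B = 4 * P^2 * (P + E) - g"
  define C where "C = P^2 * (P + E)^2 - E * g"
  have D: "0 \<le> D" and g: "0 \<le> g"
    using E w by (auto simp: D_def g_def)
  have eq: "P^2 * (2 * r + P - E)^2 - r * g = 4 * P^2 * D^2 + B * D + C"
    by (simp add: D_def B_def C_def power2_eq_square algebra_simps)
  have "0 \<le> 4 * P^2 * D^2 + B * D + C"
  \<comment> \<open>The threshold serves both cases. Below it \<open>3 * P - E\<close> is at least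
    \<open>9/4 * P\<close>, and \<open>(9/4)^2 > 5\<close> makes the discriminant nonpositive. Above
    it \<open>2 * P - E\<close> is at most \<open>5/4 * P\<close>, and \<open>(5/4)^3 < 2\<close>
    bounds \<open>g\<close>.\<close>
  proof (cases "E \<le> 3 / 4 * P")
    case True
    have eq': "16 * P^2 * (4 * P^2 * D^2 + B * D + C)
        = (8 * P^2 * D + B)^2 + g * E * ((3 * P - E)^2 - 5 * P^2)"
      unfolding B_def C_def g_def by algebra
    have "(9 / 4 * P)^2 \<le> (3 * P - E)^2"
      using True P by (intro power_mono) auto
    moreover have "5 * P^2 \<le> (9 / 4 * P)^2"
      by (simp add: power_mult_distrib power_divide)
    ultimately have "0 \<le> (3 * P - E)^2 - 5 * P^2"
      by linarith
    then have "0 \<le> g * E * ((3 * P - E)^2 - 5 * P^2)"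
      using g E by simp
    then have "0 \<le> 16 * P^2 * (4 * P^2 * D^2 + B * D + C)"
      unfolding eq' by simp
    then show ?thesis
      using P by (simp add: zero_le_mult_iff)
  next
    case False
    have "g \<le> (5 / 4 * P)^3"
      unfolding g_def using False w by (intro power_mono) auto
    also have "\<dots> \<le> 2 * P^3"
      using P by (simp add: power_mult_distrib power3_eq_cube)
    finally have g2: "g \<le> 2 * P^3" .
    have "4 * P^2 * (P + E) \<ge> 4 * P^2 * P"
      using E by (intro mult_left_mono) auto
    moreover have "4 * P^2 * P = 2 * P^3 + 2 * P^3" "0 \<le> P^3"
      using P by (simp_all add: power2_eq_square power3_eq_cube)
    ultimately have "0 \<le> B"
      unfolding B_def using g2 by linarith
    moreover have "E * g \<le> E * (2 * P^3)"
      using E g2 by (intro mult_left_mono) auto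
    then have "P^2 * (P^2 + E^2) \<le> C"
      by (simp add: C_def power2_eq_square power3_eq_cube algebra_simps)
    then have "0 \<le> C"
      by (rule order_trans[rotated]) simp
    ultimately show ?thesis
      using D by simp
  qed
  then show ?thesis
    using eq by (simp add: g_def)
qed

text \<open>The two curvatures of equal sign enter the left side only through their mean
  \<open>m\<close> and product \<open>E\<close>. The two squares on the right are bounded below by
  half the square of their bases' sum \<open>s\<close>, and \<open>m * s\<close> is bounded below in
  terms of \<open>m^2\<close>, \<open>E\<close> and \<open>P\<close>; what remains is
  \<open>triple_core\<close> with \<open>r = m^2\<close>.\<close>

lemma triple_estimate:
  fixes a b z :: real
  assumes "0 \<le> a" "0 \<le> b" "0 \<le> z" and w: "0 < 2 * (a * z + b * z - a * b) - 4"
  shows "(2 * (a * z + b * z - a * b) - 4)^3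
    \<le> 4 * ((a + z)^2 * (a * z - 1)^2 + (b + z)^2 * (b * z - 1)^2)"
proof -
  define m where "m = (a + b) / 2"
  define P where "P = m * z - 1"
  define E where "E = a * b"
  define s where "s = (a + z) * (a * z - 1) + (b + z) * (b * z - 1)"
  have w_eq: "2 * (a * z + b * z - a * b) - 4 = 2 * (2 * P - E)"
    by (simp add: P_def m_def E_def field_simps)
  have E: "0 \<le> E"
    using assms by (simp add: E_def)
  have "m^2 - E = ((a - b) / 2)^2"
    by (simp add: m_def E_def power2_eq_square field_simps)
  then have Em: "E \<le> m^2"
    using zero_le_power2[of "(a - b) / 2"] by linarith
  have PE: "0 < 2 * P - E"
    using w unfolding w_eq by simp
  then have P: "0 < P"
    using E by linarith
  have m: "0 < m"
    using P assms by (cases "m = 0") (auto simp: P_def m_def)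
  have "m * s = 2 * ((m^2 + P + 1) * P + (P + 1) * (m^2 - E))"
    unfolding s_def P_def m_def E_def by (simp add: field_simps power2_eq_square)
  also have "\<dots> \<ge> 2 * (P * (2 * m^2 + P - E))"
    using P Em by (simp add: algebra_simps)
  finally have ms: "2 * (P * (2 * m^2 + P - E)) \<le> m * s" .
  have "m^2 * (2 * (2 * P - E))^3 = 8 * (m^2 * (2 * P - E)^3)"
    by algebra
  also have "\<dots> \<le> 8 * (P^2 * (2 * m^2 + P - E)^2)"
    using triple_core[OF E Em P] PE by simp
  also have "\<dots> = 2 * (2 * (P * (2 * m^2 + P - E)))^2"
    by (simp add: power_mult_distrib)
  also have "\<dots> \<le> 2 * (m * s)^2"
  proof (intro mult_left_mono power_mono)
    have "0 \<le> 2 * m^2 + P - E"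
      using P Em zero_le_power2[of m] by linarith
    then show "0 \<le> 2 * (P * (2 * m^2 + P - E))"
      using P by simp
  qed (use ms in auto)
  also have "\<dots> = m^2 * (2 * s^2)"
    by (simp add: power_mult_distrib)
  finally have "(2 * (2 * P - E))^3 \<le> 2 * s^2"
    using m by simp
  also have "\<dots> \<le> 4 * (((a + z) * (a * z - 1))^2 + ((b + z) * (b * z - 1))^2)"
  proof -
    have "2 * (p + q)^2 \<le> 4 * (p^2 + q^2)" for p q :: real
      using zero_le_power2[of "p - q"] by (simp add: power2_sum power2_diff)
    then show ?thesis
      unfolding s_def .
  qed
  finally show ?thesis
    unfolding w_eq power_mult_distrib .
qed

text \<open>Both sides are invariant under cyclic rotation and under a common change of sign. If all
  three numbers had the same sign the left base would be negative, so up to these symmetries two are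
  nonnegative and one is nonpositive.\<close>

lemma triple_estimate_signed:
  fixes x y z :: real
  assumes w: "0 < - 2 * (x * y + y * z + z * x) - 4"
  shows "(- 2 * (x * y + y * z + z * x) - 4)^3
    \<le> 4 * ((x - y)^2 * (1 + x * y)^2 + (y - z)^2 * (1 + y * z)^2 + (z - x)^2 * (1 + z * x)^2)"
proof -
  define W where "W = (\<lambda>x y z :: real. - 2 * (x * y + y * z + z * x) - 4)"
  define G where "G = (\<lambda>x y z :: real.
    (x - y)^2 * (1 + x * y)^2 + (y - z)^2 * (1 + y * z)^2 + (z - x)^2 * (1 + z * x)^2)"
  have opposite: "W x y z ^ 3 \<le> 4 * G x y z"
    if xyz: "0 \<le> x" "0 \<le> y" "z \<le> 0" and w: "0 < W x y z" for x y z
  proof -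
    have eq: "2 * (x * - z + y * - z - x * y) - 4 = W x y z"
      by (simp add: W_def algebra_simps)
    have "W x y z ^ 3 \<le> 4 * ((x + - z)^2 * (x * - z - 1)^2 + (y + - z)^2 * (y * - z - 1)^2)"
      using triple_estimate[of x y "- z"] xyz w unfolding eq by simp
    also have "\<dots> = 4 * ((z - x)^2 * (1 + z * x)^2 + (y - z)^2 * (1 + y * z)^2)"
      by algebra
    also have "\<dots> \<le> 4 * G x y z"
      by (simp add: G_def)
    finally show ?thesis .
  qed
  have rot: "W y z x = W x y z" "G y z x = G x y z" for x y z
    by (simp_all add: W_def G_def)
  have neg: "W (- x) (- y) (- z) = W x y z" "G (- x) (- y) (- z) = G x y z" for x y z
    by (simp_all add: W_def G_def power2_commute)
  have neg_opposite: "W x y z ^ 3 \<le> 4 * G x y z"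
    if "x \<le> 0" "y \<le> 0" "0 \<le> z" "0 < W x y z" for x y z
    using opposite[of "- x" "- y" "- z"] that by (simp add: neg)
  have same: "W x y z < 0" if "0 \<le> x * y" "0 \<le> y * z" "0 \<le> z * x"
    using that by (simp add: W_def)
  have w': "0 < W x y z"
    using w by (simp add: W_def)
  consider "0 \<le> x" "0 \<le> y" "0 \<le> z" | "x \<le> 0" "y \<le> 0" "z \<le> 0"
    | "0 \<le> x" "0 \<le> y" "z \<le> 0" | "0 \<le> y" "0 \<le> z" "x \<le> 0" | "0 \<le> z" "0 \<le> x" "y \<le> 0"
    | "x \<le> 0" "y \<le> 0" "0 \<le> z" | "y \<le> 0" "z \<le> 0" "0 \<le> x" | "z \<le> 0" "x \<le> 0" "0 \<le> y"
    by linarith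
  then have "W x y z ^ 3 \<le> 4 * G x y z"
  proof cases
    case 1
    then show ?thesis using same w' by simp
  next
    case 2
    then show ?thesis using same w' by (simp add: mult_nonpos_nonpos)
  next
    case 3
    then show ?thesis using opposite w' by blast
  next
    case 4
    then show ?thesis using opposite[of y z x] w' unfolding rot[where x = x and y = y and z = z] by blast
  next
    case 5
    then show ?thesis using opposite[of z x y] w' unfolding rot[where x = z and y = x and z = y] by blast
  next
    case 6
    then show ?thesis using neg_opposite w' by blast
  next
    case 7
    then show ?thesis using neg_opposite[of y z x] w' unfolding rot[where x = x and y = y and z = z] by blast
  next
    case 8
    then show ?thesis using neg_opposite[of z x y] w' unfolding rot[where x = z and y = x and z = y] by blast
  qed
  then show ?thesis
    by (simp add: W_def G_def)
qed

text \<open>The base is \<open>\<Phi>(x, x, z) - S - 4\<close>, with \<open>x\<close> the repeated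
  curvature. Using \<open>x^2 + z^2 \<le> S\<close> replaces it by the base of
  \<open>pair_estimate\<close>, and its positivity forces \<open>x\<close> and \<open>z\<close> to
  have opposite signs.\<close>

lemma pair_estimate_signed:
  fixes x z S c :: real
  assumes S: "6 \<le> S" "x^2 + z^2 \<le> S" and c: "24 / 5 - 16 / S \<le> c" and w: "0 < z^2 - 4 * x * z - S - 4"
  shows "(z^2 - 4 * x * z - S - 4)^3 \<le> 2 * c * ((x - z)^2 * (1 + x * z)^2)"
proof -
  have le: "z^2 - 4 * x * z - S - 4 \<le> 4 * (- (x * z) - 1) - x^2"
    using S by simp
  have "x^2 < 4 * (- (x * z) - 1)"
    using w le by simp
  with zero_le_power2 have "0 < 4 * (- (x * z) - 1)"
    by (rule le_less_trans)
  then have neg: "x * z < 0"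
    by simp
  then have abs_eq: "\<bar>x\<bar> * \<bar>z\<bar> = - (x * z)"
    by (simp flip: abs_mult)
  have nz: "x \<noteq> 0" "z \<noteq> 0"
    using neg by auto
  have sum_eq: "(\<bar>x\<bar> + \<bar>z\<bar>)^2 = (x - z)^2"
    using abs_eq by (simp add: power2_sum power2_diff)
  have "(z^2 - 4 * x * z - S - 4)^3 \<le> (4 * (\<bar>x\<bar> * \<bar>z\<bar> - 1) - \<bar>x\<bar>^2)^3"
    using le w abs_eq by (intro power_mono) auto
  also have "\<dots> \<le> 2 * c * ((\<bar>x\<bar> + \<bar>z\<bar>)^2 * (\<bar>x\<bar> * \<bar>z\<bar> - 1)^2)"
    using S le w nz abs_eq by (intro pair_estimate[OF _ _ _ _ c]) auto
  also have "(\<bar>x\<bar> * \<bar>z\<bar> - 1)^2 = (1 + x * z)^2"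
    unfolding abs_eq by algebra
  finally show ?thesis
    unfolding sum_eq .
qed

section \<open>The bound at a triple of principal curvatures\<close>

lemma sum_subset_UNIV_le:
  fixes f :: "'n::finite \<Rightarrow> 'n \<Rightarrow> real"
  assumes "\<And>i j. 0 \<le> f i j"
  shows "(\<Sum>(i, j)\<in>I. f i j) \<le> (\<Sum>i\<in>UNIV. \<Sum>j\<in>UNIV. f i j)"
  unfolding sum.cartesian_product by (intro sum_mono2) (auto simp: assms)

lemma F_of_nonneg: "0 \<le> F_of \<kappa>"
  unfolding F_of_def by (intro sum_nonneg) auto

lemma le_root3_if:
  fixes w y :: real
  assumes "0 \<le> y" "0 < w \<Longrightarrow> w^3 \<le> y"
  shows "w \<le> root 3 y"
proof (cases "0 < w")
  case True
  then have "root 3 (w^3) \<le> root 3 y"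
    using assms by (intro real_root_le_mono) auto
  then show ?thesis
    by (simp add: odd_real_root_power_cancel)
next
  case False
  then show ?thesis
    using assms(1) real_root_ge_zero[of y 3] by linarith
qed

text \<open>For three distinct indices the squares sum to at most \<open>S\<close>, and
  \<open>2 \<le> c\<close> is enough. For exactly two equal indices the sharp lower bound on
  \<open>c\<close> is used. For three equal indices \<open>\<Phi>\<close> is \<open>-3\<close> times
  a square.\<close>

lemma curvature_triple_bound:
  fixes \<kappa> :: "'n::finite \<Rightarrow> real" and c S :: real
  defines "S \<equiv> \<Sum>i\<in>UNIV. (\<kappa> i)^2"
  assumes S: "6 \<le> S" and c: "2 \<le> c" "24 / 5 - 16 / S \<le> c"
  shows "(\<kappa> i)^2 + (\<kappa> j)^2 + (\<kappa> k)^2 - 2 * (\<kappa> i * \<kappa> j + \<kappa> j * \<kappa> k + \<kappa> k * \<kappa> i)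
    \<le> S + 4 + root 3 (c * F_of \<kappa>)"
proof -
  define f where "f = (\<lambda>i j. (\<kappa> i - \<kappa> j)^2 * (1 + \<kappa> i * \<kappa> j)^2)"
  have f_sym: "f j i = f i j" for i j
    by (simp add: f_def power2_commute mult.commute)
  have F: "(\<Sum>(i, j)\<in>I. f i j) \<le> F_of \<kappa>" for I
    using sum_subset_UNIV_le[of f I] by (simp add: f_def F_of_def)
  have cF: "0 \<le> c * F_of \<kappa>"
    using c F_of_nonneg[of \<kappa>] by simp
  have S_ge: "(\<Sum>i\<in>I. (\<kappa> i)^2) \<le> S" for I
    unfolding S_def by (intro sum_mono2) auto
  have pair: "(\<kappa> k)^2 - 4 * \<kappa> i * \<kappa> k \<le> S + 4 + root 3 (c * F_of \<kappa>)" if "i \<noteq> k" for i k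
  proof -
    have "(\<kappa> k)^2 - 4 * \<kappa> i * \<kappa> k - S - 4 \<le> root 3 (c * F_of \<kappa>)"
    proof (rule le_root3_if[OF cF])
      assume w: "0 < (\<kappa> k)^2 - 4 * \<kappa> i * \<kappa> k - S - 4"
      have "((\<kappa> k)^2 - 4 * \<kappa> i * \<kappa> k - S - 4)^3 \<le> 2 * c * f i k"
        using S_ge[of "{i, k}"] \<open>i \<noteq> k\<close> unfolding f_def by (intro pair_estimate_signed[OF S _ c(2) w]) simp
      also have "\<dots> = c * (\<Sum>(i, j)\<in>{(i, k), (k, i)}. f i j)"
        using \<open>i \<noteq> k\<close> by (simp add: f_sym[of k i])
      also have "\<dots> \<le> c * F_of \<kappa>"
        using F c by (intro mult_left_mono) auto
      finally show "((\<kappa> k)^2 - 4 * \<kappa> i * \<kappa> k - S - 4)^3 \<le> c * F_of \<kappa>" .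
    qed
    then show ?thesis by simp
  qed
  consider "i \<noteq> j" "j \<noteq> k" "k \<noteq> i" | "i = j" "j \<noteq> k" | "j = k" "k \<noteq> i" | "k = i" "i \<noteq> j" | "i = j" "j = k"
    by blast
  then show ?thesis
  proof cases
    case 1
    define w where "w = - 2 * (\<kappa> i * \<kappa> j + \<kappa> j * \<kappa> k + \<kappa> k * \<kappa> i) - 4"
    have "w \<le> root 3 (c * F_of \<kappa>)"
    proof (rule le_root3_if[OF cF])
      assume "0 < w"
      then have "w^3 \<le> 4 * (f i j + f j k + f k i)"
        unfolding w_def f_def by (rule triple_estimate_signed)
      \<comment> \<open>\<open>F\<close> contains each of the three pairs in both orders, which
        turns the factor 4 into 2.\<close>
      also have "\<dots> = 2 * (\<Sum>(i, j)\<in>{(i, j), (j, i), (j, k), (k, j), (k, i), (i, k)}. f i j)"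
        using 1 by (simp add: f_sym[of j i] f_sym[of k j] f_sym[of i k])
      also have "\<dots> \<le> c * F_of \<kappa>"
        using F c by (intro mult_mono sum_nonneg) (auto simp: f_def)
      finally show "w^3 \<le> c * F_of \<kappa>" .
    qed
    moreover have "(\<kappa> i)^2 + (\<kappa> j)^2 + (\<kappa> k)^2 \<le> S"
      using S_ge[of "{i, j, k}"] 1 by simp
    ultimately show ?thesis
      by (simp add: w_def)
  next
    case 2
    then show ?thesis using pair[of i k] by (simp add: power2_eq_square algebra_simps)
  next
    case 3
    then show ?thesis using pair[of j i] by (simp add: power2_eq_square algebra_simps)
  next
    case 4
    then show ?thesis using pair[of k j] by (simp add: power2_eq_square algebra_simps)
  next
    case 5
    have "0 \<le> root 3 (c * F_of \<kappa>)"
      using cF by simp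
    moreover have "(\<kappa> i)^2 + (\<kappa> j)^2 + (\<kappa> k)^2 - 2 * (\<kappa> i * \<kappa> j + \<kappa> j * \<kappa> k + \<kappa> k * \<kappa> i) = - 3 * (\<kappa> k)^2"
      by (simp add: 5 power2_eq_square)
    moreover have "0 \<le> (\<kappa> k)^2"
      by simp
    ultimately show ?thesis
      using S by linarith
  qed
qed

section \<open>Diagonalization of symmetric matrices\<close>

text \<open>A maximum point \<open>v\<close> of the quadratic form on the unit sphere of
  \<open>V\<close> is an eigenvector: the form \<open>g\<close> is nonnegative on \<open>V\<close>
  and vanishes at \<open>v\<close>, and its first-order change from \<open>v\<close> in direction
  \<open>w = c *\<^sub>R v - f v\<close> is twice the squared norm of \<open>w\<close>, so
  \<open>w = 0\<close>.\<close>

lemma eigenvector_exists: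
  fixes f :: "'a::euclidean_space \<Rightarrow> 'a"
  assumes f: "linear f" and sa: "\<And>x y. f x \<bullet> y = x \<bullet> f y"
    and V: "subspace V" "\<And>x. x \<in> V \<Longrightarrow> f x \<in> V" "V \<noteq> {0}"
  obtains v c where "v \<in> V" "norm v = 1" "f v = c *\<^sub>R v"
proof -
  obtain x0 where x0: "x0 \<in> V" "x0 \<noteq> 0"
    using V subspace_0 by blast
  define K where "K = V \<inter> sphere 0 1"
  have "compact K"
    unfolding K_def by (intro closed_Int_compact closed_subspace V compact_sphere)
  moreover have "(1 / norm x0) *\<^sub>R x0 \<in> K"
    using x0 V by (auto simp: K_def subspace_scale)
  then have "K \<noteq> {}" by blast
  moreover have "continuous_on K (\<lambda>x. f x \<bullet> x)"
    using f by (intro continuous_on_inner linear_continuous_on continuous_on_id) (simp add: linear_conv_bounded_linear)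
  ultimately obtain v where v: "v \<in> K" "\<And>y. y \<in> K \<Longrightarrow> f y \<bullet> y \<le> f v \<bullet> v"
    using continuous_attains_sup[of K "\<lambda>x. f x \<bullet> x"] by blast
  define c where "c = f v \<bullet> v"
  define g where "g = (\<lambda>x. c * (x \<bullet> x) - f x \<bullet> x)"
  have vV: "v \<in> V" and nv: "norm v = 1"
    using v by (auto simp: K_def)
  have g_nonneg: "0 \<le> g x" if "x \<in> V" for x
  proof (cases "x = 0")
    case True
    then show ?thesis by (simp add: g_def)
  next
    case False
    have "(1 / norm x) *\<^sub>R x \<in> K"
      using that False V by (auto simp: K_def subspace_scale)
    from v(2)[OF this] have "(f x \<bullet> x) / (norm x * norm x) \<le> c"
      using f by (simp add: c_def linear_cmul)
    then show ?thesis
      using False by (simp add: g_def field_simps flip: power2_norm_eq_inner power2_eq_square)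
  qed
  define w where "w = c *\<^sub>R v - f v"
  have wV: "w \<in> V"
    unfolding w_def using V vV by (intro subspace_diff subspace_scale) auto
  define \<alpha> where "\<alpha> = w \<bullet> w"
  have g_line: "g (v + t *\<^sub>R w) = 2 * t * \<alpha> + t^2 * g w" for t
  proof -
    have vv: "v \<bullet> v = 1" and fvv: "f v \<bullet> v = c"
      using nv by (simp_all add: norm_eq_1 c_def)
    have "\<alpha> = c * (v \<bullet> w) - f v \<bullet> w"
      unfolding \<alpha>_def by (subst (1) w_def) (simp add: inner_diff_left)
    then have fvw: "f v \<bullet> w = c * (v \<bullet> w) - \<alpha>" and fwv: "f w \<bullet> v = c * (v \<bullet> w) - \<alpha>"
      using sa[of w v] by (simp_all add: inner_commute)
    show ?thesis
      using f by (simp add: g_def linear_add linear_cmul inner_add_left inner_add_right vv fvv fvw fwv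
          inner_commute[of w v] power2_eq_square algebra_simps)
  qed
  have "\<alpha> = 0"
  proof (rule ccontr)
    assume "\<alpha> \<noteq> 0"
    \<comment> \<open>This \<open>t\<close> gives the increment the value
      \<open>- \<alpha>^2 * (g w + 2) / (g w + 1)^2\<close>, which is negative; the added 1 keeps
      the denominator positive even if \<open>g w = 0\<close>.\<close>
    define t where "t = - \<alpha> / (g w + 1)"
    have gw: "0 < g w + 1"
      using g_nonneg[OF wV] by simp
    have "0 \<le> 2 * t * \<alpha> + t^2 * g w"
      using g_nonneg[of "v + t *\<^sub>R w"] V vV wV by (simp add: g_line subspace_add subspace_scale)
    then have "0 \<le> (2 * t * \<alpha> + t^2 * g w) * (g w + 1)^2"
      by simp
    also have "\<dots> = - (\<alpha>^2 * (g w + 2))"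
    proof -
      have "t * (g w + 1) = - \<alpha>"
        using gw by (simp add: t_def)
      then show ?thesis
        by algebra
    qed
    finally have "\<alpha>^2 * (g w + 2) \<le> 0"
      by simp
    then show False
      using \<open>\<alpha> \<noteq> 0\<close> gw by (simp add: mult_le_0_iff)
  qed
  then have "f v = c *\<^sub>R v"
    by (simp add: \<alpha>_def w_def)
  with vV nv show thesis
    by (rule that)
qed

text \<open>Induction on the dimension: a unit eigenvector is split off, and by self-adjointness its
  orthogonal complement in \<open>V\<close> is again invariant.\<close>

lemma orthonormal_eigenbasis_exists:
  fixes f :: "'a::euclidean_space \<Rightarrow> 'a"
  assumes f: "linear f" and sa: "\<And>x y. f x \<bullet> y = x \<bullet> f y"
    and "subspace V" "\<And>x. x \<in> V \<Longrightarrow> f x \<in> V"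
  shows "\<exists>B \<subseteq> V. pairwise orthogonal B \<and> (\<forall>b\<in>B. norm b = 1 \<and> (\<exists>c. f b = c *\<^sub>R b)) \<and> V \<subseteq> span B"
  using assms(3,4)
proof (induction "dim V" arbitrary: V rule: less_induct)
  case (less V)
  show ?case
  proof (cases "V = {0}")
    case True
    then show ?thesis
      by (intro exI[of _ "{}"]) auto
  next
    case False
    obtain v c where v: "v \<in> V" "norm v = 1" "f v = c *\<^sub>R v"
      using eigenvector_exists[OF f sa less.prems False] by blast
    define V' where "V' = {x \<in> V. x \<bullet> v = 0}"
    have V': "subspace V'"
      using less.prems(1) unfolding V'_def subspace_def by (auto simp: inner_add_left)
    have "f x \<in> V'" if "x \<in> V'" for x
      using that less.prems(2) by (simp add: V'_def sa v)
    moreover have "v \<bullet> v = 1"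
      using v by (simp add: norm_eq_1)
    then have "v \<notin> V'"
      by (simp add: V'_def)
    then have "V' \<subset> V"
      using v(1) unfolding V'_def by blast
    then have "dim V' < dim V"
      using V' less.prems(1) by (intro dim_psubset) (simp add: span_eq_iff[THEN iffD2])
    ultimately obtain B where B: "B \<subseteq> V'" "pairwise orthogonal B"
      "\<forall>b\<in>B. norm b = 1 \<and> (\<exists>c. f b = c *\<^sub>R b)" "V' \<subseteq> span B"
      using less.hyps V' by meson
    have "x \<in> span (insert v B)" if "x \<in> V" for x
    proof -
      have "x - (x \<bullet> v) *\<^sub>R v \<in> V'"
        using that v \<open>v \<bullet> v = 1\<close> less.prems(1)
        by (simp add: V'_def subspace_diff subspace_scale inner_diff_left)
      then show ?thesis
        using B unfolding span_insert by blast
    qed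
    moreover have "pairwise orthogonal (insert v B)"
      using B by (auto simp: pairwise_insert V'_def orthogonal_def inner_commute)
    ultimately show ?thesis
      using B v by (intro exI[of _ "insert v B"]) (auto simp: V'_def)
  qed
qed

lemma symmetric_diagonalization:
  fixes h :: "'n::finite \<Rightarrow> 'n \<Rightarrow> real"
  assumes sym: "\<And>i j. h i j = h j i"
  obtains Q :: "'n \<Rightarrow> 'n \<Rightarrow> real" and \<mu>
  where "\<And>a b. (\<Sum>i\<in>UNIV. Q i a * Q i b) = (if a = b then 1 else 0)"
    and "\<And>i j. (\<Sum>a\<in>UNIV. Q i a * Q j a) = (if i = j then 1 else 0)"
    and "\<And>i a. (\<Sum>j\<in>UNIV. h i j * Q j a) = \<mu> a * Q i a"
proof -
  define H :: "real^'n^'n" where "H = (\<chi> i j. h i j)"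
  have "transpose H = H"
    by (simp add: H_def transpose_def sym)
  then have "(H *v x) \<bullet> y = x \<bullet> (H *v y)" for x y
    by (metis dot_lmul_matrix vector_transpose_matrix)
  then obtain B where B: "pairwise orthogonal B" "\<And>b. b \<in> B \<Longrightarrow> norm b = 1"
    "\<And>b. b \<in> B \<Longrightarrow> \<exists>c. H *v b = c *\<^sub>R b" "UNIV \<subseteq> span B"
    using orthonormal_eigenbasis_exists[of "(*v) H" UNIV] matrix_vector_mul_linear[of H] by auto
  have ind: "independent B"
    using B by (intro pairwise_orthogonal_independent) force+
  moreover have "span B = span UNIV"
    using B(4) by auto
  ultimately have "card B = CARD('n)" "finite B"
    using dim_eq_card[of B UNIV] by (simp_all add: independent_imp_finite)
  then obtain E where E: "bij_betw E (UNIV :: 'n set) B"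
    using finite_same_card_bij[of "UNIV :: 'n set" B] by auto
  then have EB: "E a \<in> B" and E_inj: "E a = E b \<longleftrightarrow> a = b" for a b
    by (auto simp: bij_betw_def inj_def)
  define Q where "Q = (\<lambda>i a. E a $ i)"
  obtain \<mu> where \<mu>: "\<And>a. H *v E a = \<mu> a *\<^sub>R E a"
    using B(3)[OF EB] by metis
  have 1: "(\<Sum>i\<in>UNIV. Q i a * Q i b) = (if a = b then 1 else 0)" for a b
  proof -
    have "(\<Sum>i\<in>UNIV. Q i a * Q i b) = E a \<bullet> E b"
      by (simp add: Q_def inner_vec_def)
    also have "\<dots> = (if a = b then 1 else 0)"
      using B(1) B(2)[OF EB] EB E_inj by (auto simp: pairwise_def orthogonal_def norm_eq_1)
    finally show ?thesis .
  qed
  define M :: "real^'n^'n" where "M = (\<chi> i a. Q i a)"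
  have "transpose M ** M = mat 1"
    by (simp add: M_def transpose_def matrix_matrix_mult_def mat_def 1 vec_eq_iff)
  then have "M ** transpose M = mat 1"
    by (simp add: matrix_left_right_inverse)
  then have "(\<Sum>a\<in>UNIV. Q i a * Q j a) = (if i = j then 1 else 0)" for i j
    by (simp add: M_def transpose_def matrix_matrix_mult_def mat_def vec_eq_iff)
  moreover have "(\<Sum>j\<in>UNIV. h i j * Q j a) = \<mu> a * Q i a" for i a
    using arg_cong[OF \<mu>[of a], of "\<lambda>x. x $ i"] by (simp add: H_def Q_def matrix_vector_mult_def)
  ultimately show thesis
    using 1 that by blast
qed

section \<open>Second derivatives\<close>

lemma DERIV_line:
  fixes g :: "'a::real_normed_vector \<Rightarrow> real"
  assumes "(g has_derivative G) (at (p + s *\<^sub>R a))"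
  shows "((\<lambda>s. g (p + s *\<^sub>R a)) has_real_derivative G a) (at s)"
proof -
  have "((\<lambda>s. p + s *\<^sub>R a) has_derivative (\<lambda>h. h *\<^sub>R a)) (at s)"
    by (auto intro!: derivative_eq_intros)
  from has_derivative_compose[OF this assms]
  have "((\<lambda>s. g (p + s *\<^sub>R a)) has_derivative (\<lambda>h. G (h *\<^sub>R a))) (at s)" .
  moreover have "G (h *\<^sub>R a) = G a * h" for h
    using has_derivative_linear[OF assms] by (simp add: linear_cmul)
  ultimately show ?thesis
    by (simp add: has_field_derivative_def)
qed

text \<open>The mean value theorem is applied first in direction \<open>a\<close> to a difference of
  \<open>g\<close>, then in direction \<open>b\<close> to the derivative found.\<close>

lemma second_difference_mean_value:
  fixes g :: "'a::real_normed_vector \<Rightarrow> real"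
  assumes h: "0 < h"
    and W: "\<And>s t. \<lbrakk>0 \<le> s; s \<le> h; 0 \<le> t; t \<le> h\<rbrakk> \<Longrightarrow> u + s *\<^sub>R a + t *\<^sub>R b \<in> W"
    and g': "\<And>x. x \<in> W \<Longrightarrow> (g has_derivative g' x) (at x)"
    and g'': "\<And>x. x \<in> W \<Longrightarrow> ((\<lambda>x. g' x a) has_derivative g'' x) (at x)"
  obtains s t where "0 \<le> s" "s \<le> h" "0 \<le> t" "t \<le> h"
    "g (u + h *\<^sub>R a + h *\<^sub>R b) - g (u + h *\<^sub>R a) - g (u + h *\<^sub>R b) + g u = h * (h * g'' (u + s *\<^sub>R a + t *\<^sub>R b) b)"
proof -
  have "((\<lambda>s. g (u + t *\<^sub>R b + s *\<^sub>R a)) has_real_derivative g' (u + t *\<^sub>R b + s *\<^sub>R a) a) (at s)"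
    if "0 \<le> s" "s \<le> h" "0 \<le> t" "t \<le> h" for s t
    using W[OF that] by (intro DERIV_line g') (simp add: add_ac)
  note D = this[of _ h] this[of _ 0]
  have "\<exists>s>0. s < h \<and>
    (g (u + h *\<^sub>R b + h *\<^sub>R a) - g (u + 0 *\<^sub>R b + h *\<^sub>R a)) - (g (u + h *\<^sub>R b + 0 *\<^sub>R a) - g (u + 0 *\<^sub>R b + 0 *\<^sub>R a))
      = (h - 0) * (g' (u + h *\<^sub>R b + s *\<^sub>R a) a - g' (u + 0 *\<^sub>R b + s *\<^sub>R a) a)"
    using h by (intro MVT2[where f = "\<lambda>s. g (u + h *\<^sub>R b + s *\<^sub>R a) - g (u + 0 *\<^sub>R b + s *\<^sub>R a)"] DERIV_diff D) auto
  then obtain s where s: "0 < s" "s < h" and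
    eq1: "g (u + h *\<^sub>R a + h *\<^sub>R b) - g (u + h *\<^sub>R a) - g (u + h *\<^sub>R b) + g u
      = h * (g' (u + s *\<^sub>R a + h *\<^sub>R b) a - g' (u + s *\<^sub>R a) a)"
    by (auto simp: algebra_simps)
  have "((\<lambda>t. g' (u + s *\<^sub>R a + t *\<^sub>R b) a) has_real_derivative g'' (u + s *\<^sub>R a + t *\<^sub>R b) b) (at t)"
    if "0 \<le> t" "t \<le> h" for t
    using s that by (intro DERIV_line[where g = "\<lambda>x. g' x a"] g'' W) auto
  then have "\<exists>t>0. t < h \<and> g' (u + s *\<^sub>R a + h *\<^sub>R b) a - g' (u + s *\<^sub>R a + 0 *\<^sub>R b) a
      = (h - 0) * g'' (u + s *\<^sub>R a + t *\<^sub>R b) b"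
    using h by (intro MVT2[where f = "\<lambda>t. g' (u + s *\<^sub>R a + t *\<^sub>R b) a"]) auto
  then obtain t where t: "0 < t" "t < h" and
    eq2: "g' (u + s *\<^sub>R a + h *\<^sub>R b) a - g' (u + s *\<^sub>R a) a = h * g'' (u + s *\<^sub>R a + t *\<^sub>R b) b"
    by auto
  show thesis
    using that[of s t] s t eq1 eq2 by simp
qed

text \<open>The second difference over a small parallelogram is symmetric in \<open>a\<close> and
  \<open>b\<close>, so the two mixed derivatives agree at a pair of points close to
  \<open>u\<close>. If they differed at \<open>u\<close>, continuity would keep each within half of
  their distance, a contradiction.\<close>

lemma second_derivative_symmetric_real:
  fixes g :: "'a::real_normed_vector \<Rightarrow> real"
  assumes W: "open W" "u \<in> W"
    and g': "\<And>x. x \<in> W \<Longrightarrow> (g has_derivative g' x) (at x)"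
    and g'': "\<And>x v. x \<in> W \<Longrightarrow> ((\<lambda>x. g' x v) has_derivative g'' v x) (at x)"
    and cont: "\<And>v w. continuous_on W (\<lambda>x. g'' v x w)"
  shows "g'' a u b = g'' b u a"
proof (rule ccontr)
  assume neq: "g'' a u b \<noteq> g'' b u a"
  define r where "r = dist (g'' a u b) (g'' b u a) / 2"
  have r: "0 < r"
    using neq by (simp add: r_def)
  have "\<forall>\<^sub>F x in at u. x \<in> W \<and> dist (g'' a x b) (g'' a u b) < r \<and> dist (g'' b x a) (g'' b u a) < r"
    using cont W r by (intro eventually_conj tendstoD[OF _ r] eventually_at_in_open')
      (auto simp: continuous_on_eq_continuous_at isCont_def)
  then obtain d where d: "0 < d" and close: "\<And>x. dist x u < d \<Longrightarrow>
      x \<in> W \<and> dist (g'' a x b) (g'' a u b) < r \<and> dist (g'' b x a) (g'' b u a) < r"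
    using W r unfolding eventually_at by (metis UNIV_I dist_self)
  define k where "k = norm a + norm b + 1"
  define h where "h = d / 2 / k"
  have pos: "0 < k"
    unfolding k_def by (intro add_nonneg_pos) auto
  have h: "0 < h"
    using d pos by (simp add: h_def)
  have near: "dist (u + s *\<^sub>R v + t *\<^sub>R w) u < d"
    if "0 \<le> s" "s \<le> h" "0 \<le> t" "t \<le> h" "{v, w} = {a, b}" for s t v w
  proof -
    have "dist (u + s *\<^sub>R v + t *\<^sub>R w) u \<le> s * norm v + t * norm w"
      using that norm_triangle_ineq[of "s *\<^sub>R v" "t *\<^sub>R w"] by (simp add: dist_norm add.assoc)
    also have "\<dots> \<le> h * norm v + h * norm w"
      using that by (intro add_mono mult_right_mono) auto
    also have "\<dots> \<le> h * k"
      using that h by (auto simp: k_def doubleton_eq_iff algebra_simps)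
    also have "\<dots> = d / 2"
      using pos by (simp add: h_def)
    also have "\<dots> < d"
      using d by simp
    finally show ?thesis .
  qed
  obtain s t where st: "0 \<le> s" "s \<le> h" "0 \<le> t" "t \<le> h" and
    eq1: "g (u + h *\<^sub>R a + h *\<^sub>R b) - g (u + h *\<^sub>R a) - g (u + h *\<^sub>R b) + g u = h * (h * g'' a (u + s *\<^sub>R a + t *\<^sub>R b) b)"
    using second_difference_mean_value[OF h _ g' g''[of _ a], where u = u and b = b] close near by blast
  obtain s' t' where st': "0 \<le> s'" "s' \<le> h" "0 \<le> t'" "t' \<le> h" and
    eq2: "g (u + h *\<^sub>R b + h *\<^sub>R a) - g (u + h *\<^sub>R b) - g (u + h *\<^sub>R a) + g u = h * (h * g'' b (u + s' *\<^sub>R b + t' *\<^sub>R a) a)"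
    using second_difference_mean_value[OF h _ g' g''[of _ b], where u = u and b = a] close near by blast
  have "h * (h * g'' a (u + s *\<^sub>R a + t *\<^sub>R b) b) = h * (h * g'' b (u + s' *\<^sub>R b + t' *\<^sub>R a) a)"
    using eq1 eq2 by (simp add: algebra_simps)
  then have "g'' a (u + s *\<^sub>R a + t *\<^sub>R b) b = g'' b (u + s' *\<^sub>R b + t' *\<^sub>R a) a"
    using h by simp
  moreover have "dist (g'' a (u + s *\<^sub>R a + t *\<^sub>R b) b) (g'' a u b) < r"
    "dist (g'' b (u + s' *\<^sub>R b + t' *\<^sub>R a) a) (g'' b u a) < r"
    using close near[OF st, of a b] near[OF st', of b a] by (auto simp: insert_commute)
  ultimately have "dist (g'' a u b) (g'' b u a) < r + r"
    by (metis add_strict_mono dist_commute dist_triangle_lt)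
  then show False
    by (simp add: r_def)
qed

section \<open>Smooth maps and derivatives along vector fields\<close>

lemma smooth_on_differentiable: "smooth_on f W \<Longrightarrow> x \<in> W \<Longrightarrow> f differentiable (at x)"
  unfolding smooth_on_def by (metis Ck_on.simps(2))

lemma smooth_on_has_derivative:
  "smooth_on f W \<Longrightarrow> x \<in> W \<Longrightarrow> (f has_derivative frechet_derivative f (at x)) (at x)"
  using smooth_on_differentiable frechet_derivative_works by blast

lemma smooth_on_frechet_derivative:
  "smooth_on f W \<Longrightarrow> smooth_on (\<lambda>x. frechet_derivative f (at x) v) W"
  unfolding smooth_on_def by (metis Ck_on.simps(2))

lemma smooth_on_continuous_on: "smooth_on f W \<Longrightarrow> continuous_on W f"
  unfolding smooth_on_def by (metis Ck_on.simps(1))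

lemma second_frechet_derivative_symmetric:
  fixes f :: "'a::euclidean_space \<Rightarrow> 'b::euclidean_space"
  assumes W: "open W" "u \<in> W" and f: "smooth_on f W"
  shows "frechet_derivative (\<lambda>x. frechet_derivative f (at x) a) (at u) b
    = frechet_derivative (\<lambda>x. frechet_derivative f (at x) b) (at u) a"
proof (rule vector_eq_ldot[THEN iffD1], intro allI)
  fix y
  have "continuous_on W (\<lambda>x. frechet_derivative (\<lambda>x. frechet_derivative f (at x) v) (at x) w \<bullet> y)" for v w
    by (intro continuous_on_inner continuous_on_const smooth_on_continuous_on smooth_on_frechet_derivative f)
  then have "frechet_derivative (\<lambda>x. frechet_derivative f (at x) a) (at u) b \<bullet> y
    = frechet_derivative (\<lambda>x. frechet_derivative f (at x) b) (at u) a \<bullet> y"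
    by (intro second_derivative_symmetric_real[OF W, where g = "\<lambda>x. f x \<bullet> y"
          and g' = "\<lambda>x v. frechet_derivative f (at x) v \<bullet> y"
          and g'' = "\<lambda>v x w. frechet_derivative (\<lambda>x. frechet_derivative f (at x) v) (at x) w \<bullet> y"])
       (auto intro!: has_derivative_inner_left smooth_on_has_derivative smooth_on_frechet_derivative f)
  then show "y \<bullet> frechet_derivative (\<lambda>x. frechet_derivative f (at x) a) (at u) b
    = y \<bullet> frechet_derivative (\<lambda>x. frechet_derivative f (at x) b) (at u) a"
    by (simp add: inner_commute)
qed

text \<open>\<open>smooth_on\<close> speaks of derivatives in fixed directions, whereas
  \<open>along b f\<close> differentiates in a moving one. Expanding \<open>b\<close> in the
  standard basis reduces to fixed directions and the product rule.\<close>

lemma has_derivative_along: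
  fixes f :: "real^'n::finite \<Rightarrow> 'b::real_normed_vector"
  assumes W: "open W" "u \<in> W" and f: "smooth_on f W" and b: "b differentiable (at u)"
  shows "(along b f has_derivative (\<lambda>v. frechet_derivative f (at u) (frechet_derivative b (at u) v)
    + (\<Sum>i\<in>UNIV. b u $ i *\<^sub>R frechet_derivative (\<lambda>x. frechet_derivative f (at x) (axis i 1)) (at u) v))) (at u)"
proof -
  have expand: "frechet_derivative f (at x) v = (\<Sum>i\<in>UNIV. v $ i *\<^sub>R frechet_derivative f (at x) (axis i 1))"
    if "x \<in> W" for x v
  proof -
    have lin: "linear (frechet_derivative f (at x))"
      using has_derivative_linear[OF smooth_on_has_derivative[OF f that]] .
    have "frechet_derivative f (at x) v = frechet_derivative f (at x) (\<Sum>i\<in>UNIV. v $ i *\<^sub>R axis i 1)"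
      by (simp add: basis_expansion scalar_mult_eq_scaleR[symmetric])
    also have "\<dots> = (\<Sum>i\<in>UNIV. v $ i *\<^sub>R frechet_derivative f (at x) (axis i 1))"
      by (simp add: linear_sum[OF lin] linear_cmul[OF lin])
    finally show ?thesis .
  qed
  have "((\<lambda>x. b x $ i) has_derivative (\<lambda>v. frechet_derivative b (at u) v $ i)) (at u)" for i
    using b bounded_linear.has_derivative[OF bounded_linear_vec_nth] frechet_derivative_works by blast
  then have "((\<lambda>x. \<Sum>i\<in>UNIV. b x $ i *\<^sub>R frechet_derivative f (at x) (axis i 1)) has_derivative
      (\<lambda>v. \<Sum>i\<in>UNIV. b u $ i *\<^sub>R frechet_derivative (\<lambda>x. frechet_derivative f (at x) (axis i 1)) (at u) v
        + frechet_derivative b (at u) v $ i *\<^sub>R frechet_derivative f (at u) (axis i 1))) (at u)"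
    by (intro has_derivative_sum has_derivative_scaleR smooth_on_has_derivative[OF _ W(2)]
        smooth_on_frechet_derivative f)
  then have "((\<lambda>x. \<Sum>i\<in>UNIV. b x $ i *\<^sub>R frechet_derivative f (at x) (axis i 1)) has_derivative
      (\<lambda>v. frechet_derivative f (at u) (frechet_derivative b (at u) v)
    + (\<Sum>i\<in>UNIV. b u $ i *\<^sub>R frechet_derivative (\<lambda>x. frechet_derivative f (at x) (axis i 1)) (at u) v))) (at u)"
    by (simp add: expand[OF W(2), of "frechet_derivative b (at u) _"] sum.distrib add.commute)
  then show ?thesis
    by (rule has_derivative_transform_within_open[OF _ W]) (simp add: along_def expand)
qed

lemma along_differentiable:
  fixes f :: "real^'n::finite \<Rightarrow> 'b::real_normed_vector"
  assumes "open W" "u \<in> W" "smooth_on f W" "b differentiable (at u)"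
  shows "along b f differentiable (at u)"
  using has_derivative_along[OF assms] by (auto simp: differentiable_def)

text \<open>The second-order terms cancel by symmetry of second derivatives, leaving the derivative
  along the Lie bracket. Applied to \<open>X\<close> it yields symmetry of \<open>h\<close> and
  absence of torsion, applied to \<open>\<nu>\<close> the Codazzi equation.\<close>

lemma along_commutator:
  fixes f :: "real^'n::finite \<Rightarrow> 'b::euclidean_space"
  assumes W: "open W" "u \<in> W" and f: "smooth_on f W"
    and a: "a differentiable (at u)" and b: "b differentiable (at u)"
  shows "along a (along b f) u - along b (along a f) u
    = frechet_derivative f (at u) (along a b u - along b a u)"
proof -
  define H where "H = (\<lambda>i v. frechet_derivative (\<lambda>x. frechet_derivative f (at x) (axis i 1)) (at u) v)"
  have H_linear: "linear (H i)" for i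
    unfolding H_def
    using has_derivative_linear[OF smooth_on_has_derivative[OF smooth_on_frechet_derivative[OF f] W(2)]] .
  have H_sym: "H i (axis j 1) = H j (axis i 1)" for i j
    unfolding H_def by (rule second_frechet_derivative_symmetric[OF W f])
  have H_expand: "H i v = (\<Sum>j\<in>UNIV. v $ j *\<^sub>R H i (axis j 1))" for i v
  proof -
    have "H i v = H i (\<Sum>j\<in>UNIV. v $ j *\<^sub>R axis j 1)"
      by (simp add: basis_expansion scalar_mult_eq_scaleR[symmetric])
    then show ?thesis
      by (simp add: linear_sum[OF H_linear] linear_cmul[OF H_linear])
  qed
  have along2: "along a (along b f) u
      = frechet_derivative f (at u) (along a b u) + (\<Sum>i\<in>UNIV. b u $ i *\<^sub>R H i (a u))"
    if "b differentiable (at u)" for a b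
    using frechet_derivative_at[OF has_derivative_along[OF W f that]]
    by (simp add: along_def[of a] H_def fun_eq_iff)
  have "(\<Sum>i\<in>UNIV. b u $ i *\<^sub>R H i (a u)) = (\<Sum>i\<in>UNIV. \<Sum>j\<in>UNIV. (b u $ i * a u $ j) *\<^sub>R H i (axis j 1))"
    by (subst H_expand) (simp add: scaleR_sum_right)
  also have "\<dots> = (\<Sum>j\<in>UNIV. \<Sum>i\<in>UNIV. (a u $ j * b u $ i) *\<^sub>R H j (axis i 1))"
    by (subst sum.swap) (simp add: mult.commute H_sym[symmetric])
  also have "\<dots> = (\<Sum>j\<in>UNIV. a u $ j *\<^sub>R H j (b u))"
    by (subst (2) H_expand) (simp add: scaleR_sum_right)
  finally have "(\<Sum>i\<in>UNIV. b u $ i *\<^sub>R H i (a u)) = (\<Sum>i\<in>UNIV. a u $ i *\<^sub>R H i (b u))" .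
  moreover have "linear (frechet_derivative f (at u))"
    using has_derivative_linear[OF smooth_on_has_derivative[OF f W(2)]] .
  ultimately show ?thesis
    by (simp add: along2[OF a] along2[OF b] linear_diff)
qed

lemma along_cong_open:
  assumes "open W" "u \<in> W" "\<And>x. x \<in> W \<Longrightarrow> f x = g x" "f differentiable (at u)"
  shows "along a f u = along a g u"
  unfolding along_def using frechet_derivative_transform_within_open[OF assms(4,1,2,3)] by simp

lemma along_inner:
  assumes "f differentiable (at u)" "g differentiable (at u)"
  shows "along a (\<lambda>x. f x \<bullet> g x) u = along a f u \<bullet> g u + f u \<bullet> along a g u"
proof -
  have "((\<lambda>x. f x \<bullet> g x) has_derivative
      (\<lambda>v. f u \<bullet> frechet_derivative g (at u) v + frechet_derivative f (at u) v \<bullet> g u)) (at u)"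
    using assms by (intro has_derivative_inner) (auto simp: frechet_derivative_works)
  from frechet_derivative_at[OF this, symmetric] show ?thesis
    by (simp add: along_def add.commute)
qed

lemma along_minus:
  assumes "f differentiable (at u)"
  shows "along a (\<lambda>x. - f x) u = - along a f u"
  using frechet_derivative_at[OF has_derivative_minus[OF assms[unfolded frechet_derivative_works]], symmetric]
  by (simp add: along_def)

lemma along_const [simp]: "along a (\<lambda>x. c) u = 0"
  by (simp add: along_def)

text \<open>By counting dimensions, \<open>N\<close>, \<open>X\<close> and the family
  \<open>E\<close> form an orthonormal basis of the ambient space, and \<open>y\<close> has no
  component along the first two.\<close>

lemma orthonormal_family_parseval:
  fixes E :: "'n::finite \<Rightarrow> 'v::euclidean_space"
  assumes dim: "DIM('v) = CARD('n) + 2"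
    and E: "\<And>i j. E i \<bullet> E j = (if i = j then 1 else 0)"
    and N: "norm N = 1" "norm X = 1" "N \<bullet> X = 0" "\<And>i. N \<bullet> E i = 0" "\<And>i. X \<bullet> E i = 0"
    and y: "y \<bullet> N = 0" "y \<bullet> X = 0"
  shows "y \<bullet> z = (\<Sum>l\<in>UNIV. (y \<bullet> E l) * (E l \<bullet> z))"
proof -
  define B where "B = insert N (insert X (range E))"
  have NX: "N \<bullet> N = 1" "X \<bullet> X = 1"
    using N by (simp_all add: norm_eq_1)
  have inj: "inj E"
    using E by (metis injI zero_neq_one)
  have notin: "N \<notin> insert X (range E)" "X \<notin> range E"
    using N NX by auto
  have orth: "pairwise orthogonal B"
    using N E by (auto simp: B_def pairwise_def orthogonal_def inner_commute)
  have norm: "norm b = 1" if "b \<in> B" for b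
    using that N E by (auto simp: B_def norm_eq_1)
  have "independent B"
    using orth norm by (intro pairwise_orthogonal_independent) force+
  moreover have "card B = DIM('v)"
    using notin inj dim by (simp add: B_def card_image)
  ultimately have "span B = UNIV"
    using card_ge_dim_independent[of B UNIV] by auto
  then have "(\<Sum>b\<in>B. (y \<bullet> b) *\<^sub>R b) = y"
    by (intro orthonormal_basis_expand orth norm) (auto simp: B_def)
  moreover have "(\<Sum>b\<in>B. (y \<bullet> b) *\<^sub>R b) = (\<Sum>l\<in>UNIV. (y \<bullet> E l) *\<^sub>R E l)"
    using notin y by (simp add: B_def sum.reindex[OF inj])
  ultimately have "y = (\<Sum>l\<in>UNIV. (y \<bullet> E l) *\<^sub>R E l)"
    by simp
  then have "y \<bullet> z = (\<Sum>l\<in>UNIV. (y \<bullet> E l) *\<^sub>R E l) \<bullet> z"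
    by simp
  then show ?thesis
    by (simp add: inner_sum_left)
qed

section \<open>The Codazzi equation\<close>

locale hypersurface_frame =
  fixes W :: "(real^'n::finite) set" and X :: "real^'n \<Rightarrow> 'v::euclidean_space"
    and e :: "'n \<Rightarrow> real^'n \<Rightarrow> real^'n" and \<nu> :: "real^'n \<Rightarrow> 'v"
  assumes dim: "DIM('v) = CARD('n) + 2"
    and X_smooth: "smooth_on X W"
    and X_norm: "\<And>x. x \<in> W \<Longrightarrow> norm (X x) = 1"
    and orthonormal: "orthonormal_frame_on W X e \<nu>"
begin

lemma W_open: "open W"
  and e_smooth: "smooth_on (e i) W"
  and \<nu>_smooth: "smooth_on \<nu> W"
  using orthonormal by (auto simp: orthonormal_frame_on_def)

lemma frame_at_point:
  assumes "x \<in> W"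
  shows "push X (e i) x \<bullet> push X (e j) x = (if i = j then 1 else 0)"
    and "norm (\<nu> x) = 1" and "\<nu> x \<bullet> X x = 0" and "\<nu> x \<bullet> push X (e i) x = 0"
  using orthonormal assms by (auto simp: orthonormal_frame_on_def)

text \<open>Orthonormality of the pushed frame makes \<open>L\<close> a left inverse of the
  coefficient map \<open>C\<close>; an injective linear endomorphism in finite dimension is
  surjective.\<close>

lemma frame_expansion:
  assumes "x \<in> W"
  shows "v = (\<Sum>l\<in>UNIV. (frechet_derivative X (at x) v \<bullet> push X (e l) x) *\<^sub>R e l x)"
proof -
  have lin: "linear (frechet_derivative X (at x))"
    using has_derivative_linear[OF smooth_on_has_derivative[OF X_smooth assms]] .
  define L where "L = (\<lambda>v. \<chi> l. frechet_derivative X (at x) v \<bullet> push X (e l) x)"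
  define C where "C = (\<lambda>c :: real^'n. \<Sum>l\<in>UNIV. c $ l *\<^sub>R e l x)"
  have LC: "L (C c) = c" for c
    using frame_at_point(1)[OF assms]
    by (simp add: L_def C_def vec_eq_iff linear_sum[OF lin] linear_cmul[OF lin] inner_sum_left
        mult_delta_right flip: along_def)
  have "linear C"
    by (intro linearI) (simp_all add: C_def scaleR_add_left sum.distrib scaleR_sum_right)
  moreover have "inj C"
    using LC by (rule inj_on_inverseI)
  ultimately have "surj C"
    by (rule linear_injective_imp_surjective) simp
  then obtain c where "v = C c"
    by blast
  then have "v = C (L v)"
    by (simp add: LC)
  then show ?thesis
    by (simp add: C_def L_def)
qed

lemma normal_orthogonal_tangent:
  assumes "x \<in> W"
  shows "\<nu> x \<bullet> frechet_derivative X (at x) v = 0"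
proof -
  have lin: "linear (frechet_derivative X (at x))"
    using has_derivative_linear[OF smooth_on_has_derivative[OF X_smooth assms]] .
  show ?thesis
    using frame_at_point(4)[OF assms]
    by (subst frame_expansion[OF assms]) (simp add: linear_sum[OF lin] linear_cmul[OF lin] inner_sum_right flip: along_def)
qed

lemma differentiable_on_W:
  assumes "x \<in> W"
  shows "X differentiable (at x)" "e i differentiable (at x)" "\<nu> differentiable (at x)"
    "along (e i) X differentiable (at x)" "along (e i) \<nu> differentiable (at x)"
  using smooth_on_differentiable[OF X_smooth assms] smooth_on_differentiable[OF e_smooth assms]
    smooth_on_differentiable[OF \<nu>_smooth assms]
    along_differentiable[OF W_open assms X_smooth] along_differentiable[OF W_open assms \<nu>_smooth]
  by auto

lemma inner_constant_along:
  assumes "u \<in> W" "\<And>x. x \<in> W \<Longrightarrow> f x \<bullet> g x = c"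
    and "f differentiable (at u)" "g differentiable (at u)"
  shows "along a f u \<bullet> g u = - (f u \<bullet> along a g u)"
proof -
  have "along a (\<lambda>x. f x \<bullet> g x) u = along a (\<lambda>x. c) u"
    using assms by (intro along_cong_open[OF W_open]) auto
  then show ?thesis
    using along_inner[OF assms(3,4), of a] by simp
qed

lemma position_orthogonal_tangent:
  assumes "x \<in> W"
  shows "X x \<bullet> along a X x = 0"
proof -
  have "along a X x \<bullet> X x = - (X x \<bullet> along a X x)"
    using assms X_norm by (intro inner_constant_along differentiable_on_W) (auto simp: norm_eq_1)
  then show ?thesis
    by (simp add: inner_commute)
qed

lemma shape_operator_tangential:
  assumes "x \<in> W"
  shows "along a \<nu> x \<bullet> \<nu> x = 0" "along a \<nu> x \<bullet> X x = 0"
proof -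
  have "along a \<nu> x \<bullet> \<nu> x = - (\<nu> x \<bullet> along a \<nu> x)"
    using assms frame_at_point(2) by (intro inner_constant_along differentiable_on_W) (auto simp: norm_eq_1)
  then show "along a \<nu> x \<bullet> \<nu> x = 0"
    by (simp add: inner_commute)
  have "along a \<nu> x \<bullet> X x = - (\<nu> x \<bullet> along a X x)"
    using assms frame_at_point(3) by (intro inner_constant_along differentiable_on_W) auto
  then show "along a \<nu> x \<bullet> X x = 0"
    using normal_orthogonal_tangent[OF assms] by (simp add: along_def)
qed

lemma tangent_parseval:
  assumes "x \<in> W" "y \<bullet> \<nu> x = 0" "y \<bullet> X x = 0"
  shows "y \<bullet> z = (\<Sum>l\<in>UNIV. (y \<bullet> push X (e l) x) * (push X (e l) x \<bullet> z))"
  using assms X_norm position_orthogonal_tangent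
  by (intro orthonormal_family_parseval[OF dim, where N = "\<nu> x" and X = "X x"]) (auto simp: frame_at_point)

text \<open>Obtained by differentiating the orthogonality of \<open>\<nu>\<close> and
  \<open>e j\<close>. Only first derivatives of \<open>X\<close> and \<open>\<nu>\<close> remain, so
  the components of \<open>h\<close> can be differentiated once more.\<close>

lemma sff_eq_shape_operator:
  assumes "x \<in> W"
  shows "sff X e \<nu> i j x = - (push X (e j) x \<bullet> along (e i) \<nu> x)"
  unfolding sff_def using assms frame_at_point(4)
  by (intro inner_constant_along differentiable_on_W) (auto simp: inner_commute)

text \<open>The two sides differ by the normal component of a Lie bracket of tangent fields, which
  is tangent.\<close>

lemma sff_sym:
  assumes "x \<in> W"
  shows "sff X e \<nu> i j x = sff X e \<nu> j i x"
proof -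
  have "along (e i) (along (e j) X) x - along (e j) (along (e i) X) x
      = frechet_derivative X (at x) (along (e i) (e j) x - along (e j) (e i) x)"
    using assms by (intro along_commutator[OF W_open _ X_smooth] differentiable_on_W)
  from arg_cong[OF this, of "\<lambda>y. y \<bullet> \<nu> x"] show ?thesis
    using normal_orthogonal_tangent[OF assms] by (simp add: sff_def inner_diff_right inner_commute)
qed

lemma sff_differentiable:
  assumes "u \<in> W"
  shows "sff X e \<nu> i j differentiable (at u)"
proof -
  have "(\<lambda>x. - (push X (e j) x \<bullet> along (e i) \<nu> x)) differentiable (at u)"
    using differentiable_on_W[OF assms] by (intro differentiable_minus differentiable_inner)
  then show ?thesis
    using sff_eq_shape_operator unfolding differentiable_def
    by (metis (mono_tags, lifting) W_open assms has_derivative_transform_within_open)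
qed

lemma along_sff:
  assumes "u \<in> W"
  shows "along (e k) (sff X e \<nu> i j) u
    = - (along (e k) (push X (e j)) u \<bullet> along (e i) \<nu> u) - push X (e j) u \<bullet> along (e k) (along (e i) \<nu>) u"
proof -
  have "along (e k) (sff X e \<nu> i j) u = along (e k) (\<lambda>x. push X (e j) x \<bullet> - along (e i) \<nu> x) u"
    using sff_differentiable sff_eq_shape_operator by (intro along_cong_open[OF W_open assms]) (auto simp: assms)
  also have "along (e k) (\<lambda>x. - along (e i) \<nu> x) u = - along (e k) (along (e i) \<nu>) u"
    using differentiable_on_W(5)[OF assms]
    by (rule along_minus)
  then have "along (e k) (\<lambda>x. push X (e j) x \<bullet> - along (e i) \<nu> x) u
    = - (along (e k) (push X (e j)) u \<bullet> along (e i) \<nu> u) - push X (e j) u \<bullet> along (e k) (along (e i) \<nu>) u"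
    using differentiable_on_W[OF assms] by (subst along_inner) auto
  finally show ?thesis .
qed

lemma dsff_sym12:
  assumes "u \<in> W"
  shows "dsff X e \<nu> i j k u = dsff X e \<nu> j i k u"
proof -
  have "along (e k) (sff X e \<nu> i j) u = along (e k) (sff X e \<nu> j i) u"
    using assms sff_sym sff_differentiable by (intro along_cong_open[OF W_open])
  then show ?thesis
    using sff_sym[OF assms] by (simp add: dsff_def)
qed

text \<open>The Levi-Civita derivative of \<open>e i\<close> in the direction \<open>e k\<close>,
  given by its coefficient vector in the parameter domain, as the frame fields are.\<close>

definition nabla :: "'n \<Rightarrow> 'n \<Rightarrow> real^'n \<Rightarrow> real^'n" where
  "nabla k i u = (\<Sum>l\<in>UNIV. conn X e k i l u *\<^sub>R e l u)"

text \<open>Both sides are recovered from the same ambient vector, the commutator applied to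
  \<open>X\<close>, by \<open>frame_expansion\<close>.\<close>

lemma nabla_torsion_free:
  assumes "u \<in> W"
  shows "nabla k i u - nabla i k u = along (e k) (e i) u - along (e i) (e k) u"
proof -
  have "along (e k) (along (e i) X) u - along (e i) (along (e k) X) u
      = frechet_derivative X (at u) (along (e k) (e i) u - along (e i) (e k) u)"
    using assms by (intro along_commutator[OF W_open _ X_smooth] differentiable_on_W)
  moreover have "nabla k i u - nabla i k u = (\<Sum>l\<in>UNIV.
      ((along (e k) (along (e i) X) u - along (e i) (along (e k) X) u) \<bullet> push X (e l) u) *\<^sub>R e l u)"
    by (simp add: nabla_def conn_def inner_diff_left scaleR_diff_left sum_subtractf)
  ultimately show ?thesis
    using frame_expansion[OF assms, of "along (e k) (e i) u - along (e i) (e k) u"] by simp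
qed

text \<open>The connection term for \<open>i\<close> becomes a derivative of \<open>\<nu>\<close>
  along \<open>nabla k i\<close>. The one for \<open>j\<close> cancels the term from differentiating
  \<open>e j\<close>: derivatives of \<open>\<nu>\<close> are tangential, so Parseval in the frame
  loses nothing.\<close>

lemma dsff_eq:
  assumes "u \<in> W"
  shows "dsff X e \<nu> i j k u
    = push X (e j) u \<bullet> (frechet_derivative \<nu> (at u) (nabla k i u) - along (e k) (along (e i) \<nu>) u)"
proof -
  have lin: "linear (frechet_derivative \<nu> (at u))"
    using has_derivative_linear[OF smooth_on_has_derivative[OF \<nu>_smooth assms]] .
  have "(\<Sum>l\<in>UNIV. conn X e k i l u * sff X e \<nu> l j u) = - (push X (e j) u \<bullet> frechet_derivative \<nu> (at u) (nabla k i u))"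
    by (simp add: sff_eq_shape_operator[OF assms] nabla_def linear_sum[OF lin] linear_cmul[OF lin]
        inner_sum_right sum_negf flip: along_def)
  moreover have "along (e i) \<nu> u \<bullet> along (e k) (push X (e j)) u
      = (\<Sum>l\<in>UNIV. (along (e i) \<nu> u \<bullet> push X (e l) u) * (push X (e l) u \<bullet> along (e k) (push X (e j)) u))"
    using assms shape_operator_tangential by (intro tangent_parseval)
  then have "(\<Sum>l\<in>UNIV. conn X e k j l u * sff X e \<nu> i l u) = - (along (e k) (push X (e j)) u \<bullet> along (e i) \<nu> u)"
    by (simp add: sff_eq_shape_operator[OF assms] conn_def sum_negf inner_commute mult.commute)
  ultimately show ?thesis
    by (simp add: dsff_def along_sff[OF assms] inner_diff_right)
qed

text \<open>By \<open>dsff_eq\<close>, exchanging \<open>i\<close> and \<open>k\<close> changes \<open>h\<^sub>i\<^sub>j\<^sub>k\<close> by the commutator of two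
  derivatives of \<open>\<nu>\<close> minus the derivative along the Lie bracket; the torsion-free connection makes
  them cancel.\<close>

lemma codazzi:
  assumes "u \<in> W"
  shows "dsff X e \<nu> i j k u = dsff X e \<nu> k j i u"
proof -
  have lin: "linear (frechet_derivative \<nu> (at u))"
    using has_derivative_linear[OF smooth_on_has_derivative[OF \<nu>_smooth assms]] .
  have "along (e k) (along (e i) \<nu>) u - along (e i) (along (e k) \<nu>) u
      = frechet_derivative \<nu> (at u) (nabla k i u - nabla i k u)"
    unfolding nabla_torsion_free[OF assms]
    using assms by (intro along_commutator[OF W_open _ \<nu>_smooth] differentiable_on_W)
  then have "frechet_derivative \<nu> (at u) (nabla k i u) - along (e k) (along (e i) \<nu>) u
      = frechet_derivative \<nu> (at u) (nabla i k u) - along (e i) (along (e k) \<nu>) u"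
    by (simp add: linear_diff[OF lin] algebra_simps)
  then show ?thesis
    by (simp add: dsff_eq[OF assms])
qed

end

section \<open>Passage to an eigenframe\<close>

text \<open>Real polynomials that agree as functions are equal, hence have the same multiset of
  roots, and the sum depends only on that multiset.\<close>

lemma charpoly_roots_sum_eq:
  fixes \<kappa> \<mu> :: "'n::finite \<Rightarrow> real" and g :: "real \<Rightarrow> 'b::comm_monoid_add"
  assumes "\<And>t. (\<Prod>i\<in>UNIV. t - \<kappa> i) = (\<Prod>i\<in>UNIV. t - \<mu> i)"
  shows "(\<Sum>i\<in>UNIV. g (\<kappa> i)) = (\<Sum>i\<in>UNIV. g (\<mu> i))"
proof -
  have roots: "proots (\<Prod>i\<in>UNIV. [:- \<rho> i, 1:]) = image_mset \<rho> (mset_set UNIV)" for \<rho> :: "'n \<Rightarrow> real"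
    by (subst proots_prod) (auto simp: sum_unfold_sum_mset)
  have "poly (\<Prod>i\<in>UNIV. [:- \<kappa> i, 1:]) = poly (\<Prod>i\<in>UNIV. [:- \<mu> i, 1:])"
    using assms by (simp add: poly_prod fun_eq_iff)
  then have "image_mset \<kappa> (mset_set UNIV) = image_mset \<mu> (mset_set UNIV)"
    by (simp add: poly_eq_poly_eq_iff flip: roots)
  then have "image_mset g (image_mset \<kappa> (mset_set UNIV)) = image_mset g (image_mset \<mu> (mset_set UNIV))"
    by simp
  then show ?thesis
    by (simp add: sum_unfold_sum_mset multiset.map_comp comp_def)
qed

locale eigenframe =
  fixes h :: "'n::finite \<Rightarrow> 'n \<Rightarrow> real" and Q :: "'n \<Rightarrow> 'n \<Rightarrow> real" and \<mu> :: "'n \<Rightarrow> real"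
  assumes h_sym: "\<And>i j. h i j = h j i"
    and Q_cols: "\<And>a b. (\<Sum>i\<in>UNIV. Q i a * Q i b) = (if a = b then 1 else 0)"
    and Q_rows: "\<And>i j. (\<Sum>a\<in>UNIV. Q i a * Q j a) = (if i = j then 1 else 0)"
    and eigen: "\<And>i a. (\<Sum>j\<in>UNIV. h i j * Q j a) = \<mu> a * Q i a"
begin

text \<open>Components with respect to the columns of \<open>Q\<close>. Tensors of rank 2 and 3 are
  transformed one slot at a time, so that Parseval and the action of \<open>h\<close> follow by
  iteration from rank 1.\<close>

definition to_frame1 :: "('n \<Rightarrow> real) \<Rightarrow> 'n \<Rightarrow> real" where
  "to_frame1 x a = (\<Sum>i\<in>UNIV. Q i a * x i)"

definition to_frame2 :: "('n \<Rightarrow> 'n \<Rightarrow> real) \<Rightarrow> 'n \<Rightarrow> 'n \<Rightarrow> real" where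
  "to_frame2 M a b = to_frame1 (\<lambda>i. to_frame1 (M i) b) a"

definition to_frame3 :: "('n \<Rightarrow> 'n \<Rightarrow> 'n \<Rightarrow> real) \<Rightarrow> 'n \<Rightarrow> 'n \<Rightarrow> 'n \<Rightarrow> real" where
  "to_frame3 T a b c = to_frame1 (\<lambda>i. to_frame2 (T i) b c) a"

lemma parseval1: "(\<Sum>a\<in>UNIV. to_frame1 x a * to_frame1 y a) = (\<Sum>i\<in>UNIV. x i * y i)"
proof -
  have "(\<Sum>a\<in>UNIV. to_frame1 x a * to_frame1 y a)
      = (\<Sum>a\<in>UNIV. \<Sum>i\<in>UNIV. \<Sum>j\<in>UNIV. x i * y j * (Q i a * Q j a))"
    by (simp add: to_frame1_def sum_product mult_ac)
  also have "\<dots> = (\<Sum>i\<in>UNIV. \<Sum>a\<in>UNIV. \<Sum>j\<in>UNIV. x i * y j * (Q i a * Q j a))"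
    by (rule sum.swap)
  also have "\<dots> = (\<Sum>i\<in>UNIV. \<Sum>j\<in>UNIV. \<Sum>a\<in>UNIV. x i * y j * (Q i a * Q j a))"
    by (intro sum.cong refl sum.swap)
  also have "\<dots> = (\<Sum>i\<in>UNIV. x i * y i)"
    by (simp add: Q_rows mult_delta_right flip: sum_distrib_left)
  finally show ?thesis .
qed

lemma parseval2:
  "(\<Sum>a\<in>UNIV. \<Sum>b\<in>UNIV. to_frame2 M a b * to_frame2 N a b) = (\<Sum>i\<in>UNIV. \<Sum>j\<in>UNIV. M i j * N i j)"
proof -
  have "(\<Sum>a\<in>UNIV. \<Sum>b\<in>UNIV. to_frame2 M a b * to_frame2 N a b)
      = (\<Sum>b\<in>UNIV. \<Sum>a\<in>UNIV. to_frame2 M a b * to_frame2 N a b)"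
    by (rule sum.swap)
  also have "\<dots> = (\<Sum>b\<in>UNIV. \<Sum>i\<in>UNIV. to_frame1 (M i) b * to_frame1 (N i) b)"
    by (simp only: to_frame2_def parseval1)
  also have "\<dots> = (\<Sum>i\<in>UNIV. \<Sum>b\<in>UNIV. to_frame1 (M i) b * to_frame1 (N i) b)"
    by (rule sum.swap)
  finally show ?thesis
    by (simp only: parseval1)
qed

lemma to_frame1_h: "to_frame1 (\<lambda>i. \<Sum>j\<in>UNIV. h i j * x j) a = \<mu> a * to_frame1 x a"
proof -
  have "to_frame1 (\<lambda>i. \<Sum>j\<in>UNIV. h i j * x j) a = (\<Sum>i\<in>UNIV. \<Sum>j\<in>UNIV. Q i a * (h i j * x j))"
    by (simp add: to_frame1_def sum_distrib_left)
  also have "\<dots> = (\<Sum>j\<in>UNIV. (\<Sum>i\<in>UNIV. h j i * Q i a) * x j)"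
    by (subst sum.swap) (simp add: sum_distrib_left sum_distrib_right h_sym[of _ "_::'n"] mult_ac)
  also have "\<dots> = (\<Sum>j\<in>UNIV. (\<mu> a * Q j a) * x j)"
    by (simp only: eigen)
  finally show ?thesis
    by (simp add: to_frame1_def sum_distrib_left mult_ac)
qed

lemma to_frame1_sum: "to_frame1 (\<lambda>i. \<Sum>j\<in>J. f i j) a = (\<Sum>j\<in>J. to_frame1 (\<lambda>i. f i j) a)"
  unfolding to_frame1_def sum_distrib_left by (rule sum.swap)

lemma to_frame1_scale: "to_frame1 (\<lambda>i. c * f i) a = c * to_frame1 f a"
  by (simp add: to_frame1_def sum_distrib_left mult_ac)

lemma to_frame1_swap: "to_frame1 (\<lambda>i. to_frame1 (\<lambda>j. M i j) b) a = to_frame1 (\<lambda>j. to_frame1 (\<lambda>i. M i j) a) b"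
  unfolding to_frame1_def sum_distrib_left by (subst sum.swap) (simp add: mult_ac)

lemma to_frame3_sym12:
  assumes "\<And>i j k. T i j k = T j i k"
  shows "to_frame3 T a b c = to_frame3 T b a c"
proof -
  have "to_frame3 T a b c = to_frame3 (\<lambda>i j. T j i) b a c"
    unfolding to_frame3_def to_frame2_def by (rule to_frame1_swap)
  moreover have "(\<lambda>i j. T j i) = T"
    by (intro ext) (rule assms[symmetric])
  ultimately show ?thesis
    by simp
qed

lemma to_frame3_sym23:
  assumes "\<And>i j k. T i j k = T i k j"
  shows "to_frame3 T a b c = to_frame3 T a c b"
proof -
  have "to_frame2 (T i) b c = to_frame2 (\<lambda>j k. T i k j) c b" for i
    unfolding to_frame2_def by (rule to_frame1_swap)
  then have "to_frame3 T a b c = to_frame3 (\<lambda>i j k. T i k j) a c b"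
    by (simp only: to_frame3_def)
  moreover have "(\<lambda>i j k. T i k j) = T"
    by (intro ext) (rule assms[symmetric])
  ultimately show ?thesis
    by simp
qed

section \<open>The scalar invariants in the eigenframe\<close>

lemma grad_norm2_to_frame3: "grad_norm2 T = (\<Sum>a\<in>UNIV. \<Sum>b\<in>UNIV. \<Sum>c\<in>UNIV. (to_frame3 T a b c)\<^sup>2)"
proof -
  have "(\<Sum>a\<in>UNIV. \<Sum>b\<in>UNIV. \<Sum>c\<in>UNIV. to_frame3 T a b c * to_frame3 T a b c)
      = (\<Sum>b\<in>UNIV. \<Sum>a\<in>UNIV. \<Sum>c\<in>UNIV. to_frame3 T a b c * to_frame3 T a b c)"
    by (rule sum.swap)
  also have "\<dots> = (\<Sum>b\<in>UNIV. \<Sum>c\<in>UNIV. \<Sum>a\<in>UNIV. to_frame3 T a b c * to_frame3 T a b c)"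
    by (intro sum.cong refl sum.swap)
  also have "\<dots> = (\<Sum>b\<in>UNIV. \<Sum>i\<in>UNIV. \<Sum>c\<in>UNIV. to_frame2 (T i) b c * to_frame2 (T i) b c)"
    unfolding to_frame3_def parseval1 by (intro sum.cong refl sum.swap)
  also have "\<dots> = (\<Sum>i\<in>UNIV. \<Sum>b\<in>UNIV. \<Sum>c\<in>UNIV. to_frame2 (T i) b c * to_frame2 (T i) b c)"
    by (rule sum.swap)
  finally show ?thesis
    by (simp add: parseval2 grad_norm2_def power2_eq_square)
qed

text \<open>\<open>A\<close> is the squared norm of the tensor obtained by applying \<open>h\<close>
  to the last slot of \<open>T\<close>; in the eigenframe this multiplies the component by
  \<open>\<mu> c\<close>.\<close>

lemma A_of_to_frame3: "A_of h T = (\<Sum>a\<in>UNIV. \<Sum>b\<in>UNIV. \<Sum>c\<in>UNIV. (\<mu> c)\<^sup>2 * (to_frame3 T a b c)\<^sup>2)"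
proof -
  define hT where "hT = (\<lambda>i j m. \<Sum>k\<in>UNIV. h m k * T i j k)"
  have "A_of h T = grad_norm2 hT"
  proof -
    have "(\<Sum>k\<in>UNIV. \<Sum>l\<in>UNIV. \<Sum>m\<in>UNIV. T i j k * T i j l * h k m * h m l) = (\<Sum>m\<in>UNIV. (hT i j m)\<^sup>2)" for i j
    proof -
      have "(\<Sum>k\<in>UNIV. \<Sum>l\<in>UNIV. \<Sum>m\<in>UNIV. T i j k * T i j l * h k m * h m l)
          = (\<Sum>k\<in>UNIV. \<Sum>m\<in>UNIV. \<Sum>l\<in>UNIV. (h m k * T i j k) * (h m l * T i j l))"
        by (subst sum.swap) (simp add: h_sym[of _ "_ :: 'n"] mult_ac)
      also have "\<dots> = (\<Sum>m\<in>UNIV. \<Sum>k\<in>UNIV. \<Sum>l\<in>UNIV. (h m k * T i j k) * (h m l * T i j l))"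
        by (rule sum.swap)
      finally show ?thesis
        by (simp add: hT_def power2_eq_square sum_product)
    qed
    then show ?thesis
      by (simp add: A_of_def grad_norm2_def)
  qed
  moreover have "to_frame3 hT a b c = \<mu> c * to_frame3 T a b c" for a b c
    by (simp add: to_frame3_def to_frame2_def hT_def to_frame1_h to_frame1_scale)
  ultimately show ?thesis
    by (simp add: grad_norm2_to_frame3 power_mult_distrib)
qed

lemma to_frame2_h2:
  "to_frame2 (\<lambda>i j. \<Sum>m\<in>UNIV. h i m * (\<Sum>l\<in>UNIV. h j l * M m l)) a b = \<mu> a * (\<mu> b * to_frame2 M a b)"
proof -
  have "to_frame1 (\<lambda>j. \<Sum>m\<in>UNIV. h i m * (\<Sum>l\<in>UNIV. h j l * M m l)) b
      = (\<Sum>m\<in>UNIV. h i m * (\<mu> b * to_frame1 (M m) b))" for i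
    by (subst to_frame1_sum) (simp only: to_frame1_scale to_frame1_h)
  then show ?thesis
    by (simp only: to_frame2_def to_frame1_h to_frame1_scale)
qed

context
  fixes T :: "'n \<Rightarrow> 'n \<Rightarrow> 'n \<Rightarrow> real"
  assumes T_sym12: "\<And>i j k. T i j k = T j i k" and T_sym23: "\<And>i j k. T i j k = T i k j"
begin

text \<open>For fixed \<open>k\<close>, total symmetry turns the summand into the pairing of the
  matrix \<open>T k\<close> with \<open>N k\<close>, which is \<open>T k\<close> multiplied by
  \<open>h\<close> on both sides. The eigenframe replaces the two factors \<open>h\<close> by
  \<open>\<mu> a\<close> and \<open>\<mu> b\<close>.\<close>

lemma B_of_to_frame3: "B_of h T = (\<Sum>a\<in>UNIV. \<Sum>b\<in>UNIV. \<Sum>c\<in>UNIV. \<mu> a * \<mu> b * (to_frame3 T a b c)\<^sup>2)"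
proof -
  define N where "N = (\<lambda>k i j. \<Sum>m\<in>UNIV. h i m * (\<Sum>l\<in>UNIV. h j l * T k m l))"
  have T_rot: "T i j k = T k i j" for i j k
    using T_sym12 T_sym23 by metis
  have inner: "(\<Sum>l\<in>UNIV. \<Sum>m\<in>UNIV. T i j k * T k l m * h i m * h j l) = T k i j * N k i j" for i j k
  proof -
    have "(\<Sum>l\<in>UNIV. \<Sum>m\<in>UNIV. T i j k * T k l m * h i m * h j l)
        = (\<Sum>m\<in>UNIV. \<Sum>l\<in>UNIV. T i j k * T k l m * h i m * h j l)"
      by (rule sum.swap)
    also have "\<dots> = (\<Sum>m\<in>UNIV. \<Sum>l\<in>UNIV. T k i j * (h i m * (h j l * T k m l)))"
      by (intro sum.cong refl) (simp add: T_rot[of i j k] T_sym23[of k])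
    finally show ?thesis
      by (simp add: N_def sum_distrib_left)
  qed
  have outer: "(\<Sum>i\<in>UNIV. \<Sum>j\<in>UNIV. T k i j * N k i j)
      = (\<Sum>a\<in>UNIV. \<Sum>b\<in>UNIV. to_frame2 (T k) a b * (\<mu> a * (\<mu> b * to_frame2 (T k) a b)))" for k
    by (subst parseval2[symmetric]) (simp only: N_def to_frame2_h2)
  have "B_of h T = (\<Sum>i\<in>UNIV. \<Sum>j\<in>UNIV. \<Sum>k\<in>UNIV. T k i j * N k i j)"
    by (simp only: B_of_def inner)
  also have "\<dots> = (\<Sum>i\<in>UNIV. \<Sum>k\<in>UNIV. \<Sum>j\<in>UNIV. T k i j * N k i j)"
    by (intro sum.cong refl sum.swap)
  also have "\<dots> = (\<Sum>k\<in>UNIV. \<Sum>i\<in>UNIV. \<Sum>j\<in>UNIV. T k i j * N k i j)"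
    by (rule sum.swap)
  also have "\<dots> = (\<Sum>k\<in>UNIV. \<Sum>a\<in>UNIV. \<Sum>b\<in>UNIV. to_frame2 (T k) a b * (\<mu> a * (\<mu> b * to_frame2 (T k) a b)))"
    by (simp only: outer)
  also have "\<dots> = (\<Sum>a\<in>UNIV. \<Sum>k\<in>UNIV. \<Sum>b\<in>UNIV. to_frame2 (T k) a b * (\<mu> a * (\<mu> b * to_frame2 (T k) a b)))"
    by (rule sum.swap)
  also have "\<dots> = (\<Sum>a\<in>UNIV. \<Sum>b\<in>UNIV. \<Sum>k\<in>UNIV. to_frame2 (T k) a b * (\<mu> a * (\<mu> b * to_frame2 (T k) a b)))"
    by (intro sum.cong refl sum.swap)
  also have "\<dots> = (\<Sum>a\<in>UNIV. \<Sum>b\<in>UNIV. \<mu> a * \<mu> b * (\<Sum>k\<in>UNIV. to_frame2 (T k) a b * to_frame2 (T k) a b))"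
    by (simp add: sum_distrib_left mult_ac)
  also have "\<dots> = (\<Sum>a\<in>UNIV. \<Sum>b\<in>UNIV. \<mu> a * \<mu> b * (\<Sum>c\<in>UNIV. to_frame3 T c a b * to_frame3 T c a b))"
    by (simp only: to_frame3_def parseval1)
  also have "to_frame3 T c a b = to_frame3 T a b c" for a b c
    using to_frame3_sym12[of T c a b, OF T_sym12] to_frame3_sym23[of T a c b, OF T_sym23] by simp
  then have "(\<Sum>a\<in>UNIV. \<Sum>b\<in>UNIV. \<mu> a * \<mu> b * (\<Sum>c\<in>UNIV. to_frame3 T c a b * to_frame3 T c a b))
      = (\<Sum>a\<in>UNIV. \<Sum>b\<in>UNIV. \<Sum>c\<in>UNIV. \<mu> a * \<mu> b * (to_frame3 T a b c)\<^sup>2)"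
    by (simp add: sum_distrib_left power2_eq_square)
  finally show ?thesis .
qed

text \<open>The squared components are symmetric in their indices, so \<open>A\<close> and
  \<open>B\<close> each have three expressions with permuted weights; adding them explains the
  factor 3 and produces the symmetric weight bounded by \<open>K\<close>.\<close>

lemma A_B_bound:
  assumes K: "\<And>a b c. (\<mu> a)\<^sup>2 + (\<mu> b)\<^sup>2 + (\<mu> c)\<^sup>2 - 2 * (\<mu> a * \<mu> b + \<mu> b * \<mu> c + \<mu> c * \<mu> a) \<le> K"
  shows "3 * (A_of h T - 2 * B_of h T) \<le> K * grad_norm2 T"
proof -
  define D where "D = (\<lambda>a b c. (to_frame3 T a b c)\<^sup>2)"
  define sum3 :: "('n \<Rightarrow> 'n \<Rightarrow> 'n \<Rightarrow> real) \<Rightarrow> real"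
    where "sum3 = (\<lambda>f. \<Sum>a\<in>UNIV. \<Sum>b\<in>UNIV. \<Sum>c\<in>UNIV. f a b c)"
  have D12: "D a b c = D b a c" and D23: "D a b c = D a c b" for a b c
    using to_frame3_sym12[of T, OF T_sym12] to_frame3_sym23[of T, OF T_sym23] by (simp_all add: D_def)
  have swap12: "sum3 (\<lambda>a b c. f b a c * D a b c) = sum3 (\<lambda>a b c. f a b c * D a b c)" for f
    unfolding sum3_def by (subst sum.swap) (simp add: D12)
  have swap23: "sum3 (\<lambda>a b c. f a c b * D a b c) = sum3 (\<lambda>a b c. f a b c * D a b c)" for f
    unfolding sum3_def by (subst (2) sum.swap) (simp add: D23)
  have A: "A_of h T = sum3 (\<lambda>a b c. (\<mu> c)\<^sup>2 * D a b c)"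
    by (simp add: A_of_to_frame3 sum3_def D_def)
  then have A2: "A_of h T = sum3 (\<lambda>a b c. (\<mu> b)\<^sup>2 * D a b c)"
    using swap23[of "\<lambda>a b c. (\<mu> b)\<^sup>2"] by simp
  then have A3: "A_of h T = sum3 (\<lambda>a b c. (\<mu> a)\<^sup>2 * D a b c)"
    using swap12[of "\<lambda>a b c. (\<mu> a)\<^sup>2"] by simp
  have B: "B_of h T = sum3 (\<lambda>a b c. \<mu> a * \<mu> b * D a b c)"
    by (simp add: B_of_to_frame3 sum3_def D_def)
  then have B2: "B_of h T = sum3 (\<lambda>a b c. \<mu> c * \<mu> a * D a b c)"
    using swap23[of "\<lambda>a b c. \<mu> a * \<mu> b"] by (simp add: mult_ac)
  then have B3: "B_of h T = sum3 (\<lambda>a b c. \<mu> b * \<mu> c * D a b c)"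
    using swap12[of "\<lambda>a b c. \<mu> c * \<mu> a"] by (simp add: mult_ac)
  have "3 * (A_of h T - 2 * B_of h T) = A_of h T + A_of h T + A_of h T - 2 * (B_of h T + B_of h T + B_of h T)"
    by simp
  also have "\<dots> = sum3 (\<lambda>a b c. ((\<mu> a)\<^sup>2 + (\<mu> b)\<^sup>2 + (\<mu> c)\<^sup>2
      - 2 * (\<mu> a * \<mu> b + \<mu> b * \<mu> c + \<mu> c * \<mu> a)) * D a b c)"
    by (subst (1) A3, subst (1) A2, subst (1) A, subst (1) B, subst (1) B3, subst (1) B2)
       (simp add: sum3_def sum.distrib sum_subtractf sum_distrib_left algebra_simps)
  also have "\<dots> \<le> sum3 (\<lambda>a b c. K * D a b c)"
    unfolding sum3_def using K by (intro sum_mono mult_right_mono) (auto simp: D_def)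
  also have "\<dots> = K * grad_norm2 T"
    by (simp add: sum3_def grad_norm2_to_frame3 D_def sum_distrib_left)
  finally show ?thesis .
qed

end

section \<open>Comparison of the eigenframe with a given list of principal curvatures\<close>

lemma h_expansion: "h i j = (\<Sum>a\<in>UNIV. Q i a * (\<mu> a * Q j a))"
proof -
  have "(\<Sum>a\<in>UNIV. Q i a * (\<mu> a * Q j a)) = (\<Sum>a\<in>UNIV. \<Sum>k\<in>UNIV. h j k * (Q i a * Q k a))"
    by (simp add: eigen[symmetric] sum_distrib_left mult_ac)
  also have "\<dots> = (\<Sum>k\<in>UNIV. h j k * (\<Sum>a\<in>UNIV. Q i a * Q k a))"
    by (subst sum.swap) (simp add: sum_distrib_left)
  also have "\<dots> = h i j"
    by (simp add: Q_rows mult_delta_right h_sym[of j])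
  finally show ?thesis ..
qed

text \<open>\<open>\<kappa>\<close> and \<open>\<mu>\<close> may list the eigenvalues in different
  orders. Conjugating by the orthogonal matrix \<open>M\<close> diagonalizes the characteristic
  matrix, so both lists are roots of the same polynomial.\<close>

lemma principal_curvatures_sum_eq:
  assumes "principal_curvatures h \<kappa>"
  shows "(\<Sum>i\<in>UNIV. g (\<kappa> i)) = (\<Sum>i\<in>UNIV. g (\<mu> i))"
proof (rule charpoly_roots_sum_eq)
  fix t
  define M :: "real^'n^'n" where "M = (\<chi> i a. Q i a)"
  define L :: "real^'n^'n" where "L = (\<chi> a b. if a = b then t - \<mu> a else 0)"
  have "M ** transpose M = mat 1"
    by (simp add: M_def transpose_def matrix_matrix_mult_def mat_def Q_rows vec_eq_iff)
  then have "det M * det (transpose M) = 1"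
    by (metis det_I det_mul)
  moreover have "mat t - (\<chi> i j. h i j) = M ** L ** transpose M"
  proof -
    have "(M ** L ** transpose M) $ i $ j = (mat t - (\<chi> i j. h i j)) $ i $ j" for i j
    proof -
      have "(M ** L ** transpose M) $ i $ j = (\<Sum>a\<in>UNIV. Q i a * (t - \<mu> a) * Q j a)"
        by (simp add: M_def L_def transpose_def matrix_matrix_mult_def mult_delta_right)
      also have "\<dots> = t * (\<Sum>a\<in>UNIV. Q i a * Q j a) - h i j"
        by (simp add: h_expansion sum_distrib_left sum_subtractf[symmetric] algebra_simps)
      finally show ?thesis
        by (simp add: Q_rows mat_def)
    qed
    then show ?thesis
      by (simp add: vec_eq_iff)
  qed
  ultimately have "det (mat t - (\<chi> i j. h i j)) = det L"
    by (simp add: det_mul)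
  also have "\<dots> = (\<Prod>a\<in>UNIV. t - \<mu> a)"
    by (subst det_diagonal) (auto simp: L_def)
  finally show "(\<Prod>i\<in>UNIV. t - \<kappa> i) = (\<Prod>i\<in>UNIV. t - \<mu> i)"
    using assms by (simp add: principal_curvatures_def)
qed

text \<open>The double sum is converted one variable at a time, the other being held fixed.\<close>

lemma F_of_eigen:
  assumes "principal_curvatures h \<kappa>"
  shows "F_of \<kappa> = F_of \<mu>"
proof -
  have "(\<Sum>j\<in>UNIV. (x - \<kappa> j)\<^sup>2 * (1 + x * \<kappa> j)\<^sup>2) = (\<Sum>j\<in>UNIV. (x - \<mu> j)\<^sup>2 * (1 + x * \<mu> j)\<^sup>2)" for x
    by (rule principal_curvatures_sum_eq[OF assms])
  then have "F_of \<kappa> = (\<Sum>i\<in>UNIV. \<Sum>j\<in>UNIV. (\<kappa> i - \<mu> j)\<^sup>2 * (1 + \<kappa> i * \<mu> j)\<^sup>2)"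
    by (simp only: F_of_def)
  also have "\<dots> = F_of \<mu>"
    unfolding F_of_def by (rule principal_curvatures_sum_eq[OF assms])
  finally show ?thesis .
qed

lemma S_of_eigen: "S_of h = (\<Sum>a\<in>UNIV. (\<mu> a)\<^sup>2)"
proof -
  have "(\<Sum>j\<in>UNIV. (h i j)\<^sup>2) = (\<Sum>a\<in>UNIV. (\<mu> a * Q i a)\<^sup>2)" for i
    using parseval1[of "h i" "h i"]
    by (simp add: to_frame1_def mult.commute[of "Q _ _"] eigen power2_eq_square)
  then have "S_of h = (\<Sum>i\<in>UNIV. \<Sum>a\<in>UNIV. (\<mu> a * Q i a)\<^sup>2)"
    by (simp only: S_of_def)
  also have "\<dots> = (\<Sum>a\<in>UNIV. \<Sum>i\<in>UNIV. (\<mu> a * Q i a)\<^sup>2)"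
    by (rule sum.swap)
  also have "\<dots> = (\<Sum>a\<in>UNIV. (\<mu> a)\<^sup>2 * (\<Sum>i\<in>UNIV. Q i a * Q i a))"
    by (simp add: sum_distrib_left power2_eq_square mult_ac)
  finally show ?thesis
    by (simp add: Q_cols)
qed

end

lemma eigenframe_exists:
  fixes h :: "'n::finite \<Rightarrow> 'n \<Rightarrow> real"
  assumes sym: "\<And>i j. h i j = h j i"
  obtains Q \<mu> where "eigenframe h Q \<mu>"
proof (rule symmetric_diagonalization[OF sym])
  fix Q :: "'n \<Rightarrow> 'n \<Rightarrow> real" and \<mu>
  assume "\<And>a b. (\<Sum>i\<in>UNIV. Q i a * Q i b) = (if a = b then 1 else 0)"
    and "\<And>i j. (\<Sum>a\<in>UNIV. Q i a * Q j a) = (if i = j then 1 else 0)"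
    and "\<And>i a. (\<Sum>j\<in>UNIV. h i j * Q j a) = \<mu> a * Q i a"
  then have "eigenframe h Q \<mu>"
    by (intro eigenframe.intro sym)
  then show thesis
    by (rule that)
qed

section \<open>From a frame at a point of \<open>M\<close> to the pointwise estimate\<close>

lemma Ck_on_subset: "Ck_on k f U \<Longrightarrow> W \<subseteq> U \<Longrightarrow> Ck_on k f W"
  by (induction k arbitrary: f) (auto intro: continuous_on_subset)

lemma hypersurface_frame_of_frame_at:
  fixes \<A> :: "('n::finite, 'm) atlas" and x :: "'m \<Rightarrow> 'v::euclidean_space"
  assumes M: "sphere_hypersurface M \<A> x" and frame: "frame_at \<A> x p X e \<nu> u"
  obtains W where "u \<in> W" "hypersurface_frame W X e \<nu>"
proof -
  obtain U \<phi> W where U: "(U, \<phi>) \<in> \<A>" "W \<subseteq> U" "u \<in> W" "X = x \<circ> \<phi>" "orthonormal_frame_on W X e \<nu>"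
    using frame unfolding frame_at_def by blast
  have "smooth_on X U"
    using M U unfolding sphere_hypersurface_def by blast
  then have "smooth_on X W"
    using Ck_on_subset U(2) unfolding smooth_on_def by blast
  moreover have "norm (X w) = 1" if "w \<in> W" for w
  proof -
    have "\<phi> w \<in> topspace M"
      using M U that unfolding sphere_hypersurface_def smooth_manifold_def by auto
    then have "x (\<phi> w) \<in> sphere 0 1"
      using M unfolding sphere_hypersurface_def by blast
    then show ?thesis
      by (simp add: U(4))
  qed
  moreover have "DIM('v) = CARD('n) + 2"
    using M unfolding sphere_hypersurface_def by blast
  ultimately have "hypersurface_frame W X e \<nu>"
    using U(5) by unfold_locales auto
  with U(3) show thesis
    by (rule that)
qed

theorem theorem3p1:
  fixes M :: "'m topology" and \<A> :: "('n::finite, 'm) atlas"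
    and x :: "'m \<Rightarrow> 'v::euclidean_space" and \<eta> :: real
    and p :: 'm and X :: "real ^ 'n \<Rightarrow> 'v" and e :: "'n \<Rightarrow> real ^ 'n \<Rightarrow> real ^ 'n"
    and \<nu> :: "real ^ 'n \<Rightarrow> 'v" and u :: "real ^ 'n" and \<kappa> :: "'n \<Rightarrow> real"
  defines "n \<equiv> CARD('n)"
  defines "c \<equiv> 24 / 5 - 16 / ((1 + inverse \<eta>) * real n)"
  defines "h \<equiv> (\<lambda>i j. sff X e \<nu> i j u)"
  defines "dh \<equiv> (\<lambda>i j k. dsff X e \<nu> i j k u)"
  assumes minimal: "minimal_sphere_hypersurface M \<A> x"
    and n: "n \<ge> 6"
    and \<eta>: "\<eta> > 0"
    and S_bounds: "\<And>q Y f \<mu> w. \<lbrakk>q \<in> topspace M; frame_at \<A> x q Y f \<mu> w\<rbrakk> \<Longrightarrow>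
           real n \<le> S_of (\<lambda>i j. sff Y f \<mu> i j w) \<and>
           S_of (\<lambda>i j. sff Y f \<mu> i j w) \<le> (1 + inverse \<eta>) * real n"
    and p: "p \<in> topspace M"
    and frame: "frame_at \<A> x p X e \<nu> u"
    and \<kappa>: "principal_curvatures h \<kappa>"
  shows "3 * (A_of h dh - 2 * B_of h dh)
           \<le> (S_of h + 4 + root 3 (c * F_of \<kappa>)) * grad_norm2 dh"
proof -
  obtain W where u: "u \<in> W" and "hypersurface_frame W X e \<nu>"
    using hypersurface_frame_of_frame_at[OF _ frame] minimal unfolding minimal_sphere_hypersurface_def by blast
  then interpret hypersurface_frame W X e \<nu>
    by simp
  have h_sym: "h i j = h j i" for i j
    unfolding h_def by (rule sff_sym[OF u])
  have dh12: "dh i j k = dh j i k" and dh13: "dh i j k = dh k j i" for i j k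
    unfolding dh_def by (rule dsff_sym12[OF u], rule codazzi[OF u])
  have dh23: "dh i j k = dh i k j" for i j k
    using dh12 dh13 by metis
  obtain Q \<mu> where "eigenframe h Q \<mu>"
    using eigenframe_exists[of h] h_sym by blast
  then interpret eigenframe h Q \<mu>
    by simp
  have S: "real n \<le> S_of h" "S_of h \<le> (1 + inverse \<eta>) * real n"
    using S_bounds[OF p frame] by (simp_all add: h_def)
  then have S6: "6 \<le> S_of h"
    using n by linarith
  \<comment> \<open>The upper bound on \<open>S\<close> makes \<open>c\<close> at least
    \<open>24/5 - 16/S\<close>; the lower bound \<open>S \<ge> n \<ge> 6\<close> makes this at least
    \<open>24/5 - 16/6 = 32/15\<close>, which exceeds 2.\<close>
  then have "16 / ((1 + inverse \<eta>) * real n) \<le> 16 / S_of h" "16 / S_of h \<le> 16 / 6"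
    using S by (intro divide_left_mono; simp)+
  then have "24 / 5 - 16 / S_of h \<le> c" "2 \<le> c"
    by (simp_all add: c_def)
  then have "3 * (A_of h dh - 2 * B_of h dh) \<le> (S_of h + 4 + root 3 (c * F_of \<mu>)) * grad_norm2 dh"
    using S6 dh12 dh23 unfolding S_of_eigen
    by (intro A_B_bound curvature_triple_bound) auto
  then show ?thesis
    by (simp add: F_of_eigen[OF \<kappa>])
qed

end
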